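(* For an integer $n\ge 1$ let $d(n)$ denote the zeta regularized determinant of the Laplacian on the unit equilateral orthogonal torus $\mathbb{R}^n/\mathbb{Z}^n$. Then $d(n)$ is a strictly decreasing function of $n$, and $d(n)\to 0$ as $n\to\infty$. Moreover, the zeta regularized determinant on the space of orthogonal tori of dimension $n$ and unit volume tends to zero as $n\to\infty$, i.e. the supremum of the zeta regularized determinant of the Laplacian over all orthogonal tori $\mathbb{R}^n/D\mathbb{Z}^n$ with $D$ an invertible diagonal real $n\times n$ matrix with $|\det D|=1$ tends to $0$ as $n\to\infty$.
   Context: An $n$-dimensional orthogonal torus is the flat Riemannian manifold $\mathbb{R}^n/D\mathbb{Z}^n$ with $D$ a diagonal invertible real $n\times n$ matrix; its volume is $|\det D|$. For $D=\operatorname{diag}(q_1,\dots,q_n)$, the eigenvalues of the (nonnegative) Laplacian on $\mathbb{R}^n/D\mathbb{Z}^n$, counted with multiplicity, are $\lambda_k = 4\pi^2\sum_{j=1}^n k_j^2/q_j^2$, $k\in\mathbb{Z}^n$. The spectral zeta function is $\zeta_\circ(s)=\sum_{k\in\mathbb{Z}^n\setminus\{0\}}\lambda_k^{-s}$ for $\operatorname{Re}(s)>n/2$. It extends meromorphically to $\mathbb{C}$ and is holomorphic near $s=0$. The zeta regularized determinant of the Laplacian is $e^{-\zeta_\circ'(0)}$, where $\zeta_\circ'(0)$ is computed from this continuation. *)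

theory Defs
  imports
    "HOL-Complex_Analysis.Complex_Analysis"
    "Jordan_Normal_Form.Determinant"
begin

unbundle no vec_syntax

(* D represents the flat torus R^n / D Z^n. *)
definition orthogonal_tori :: "nat \<Rightarrow> real mat set" where
  "orthogonal_tori n = {D \<in> carrier_mat n n. diagonal_mat D \<and> invertible_mat D}"

definition torus_volume :: "real mat \<Rightarrow> real" where
  "torus_volume D = \<bar>Determinant.det D\<bar>"

definition unit_orthogonal_tori :: "nat \<Rightarrow> real mat set" where
  "unit_orthogonal_tori n = {D \<in> orthogonal_tori n. torus_volume D = 1}"

(* Eigenvalue of the nonnegative Laplacian on R^n / D Z^n belonging to the eigenfunction
   x |-> exp (2 pi i sum_j k_j x_j / q_j), where D = diag (q_0, ..., q_(n-1)).  As k ranges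
   over Z^n these exhaust the spectrum with multiplicity. *)
definition laplace_eigenvalue :: "real mat \<Rightarrow> int vec \<Rightarrow> real" where
  "laplace_eigenvalue D k =
     4 * pi\<^sup>2 * (\<Sum>j<dim_row D. (real_of_int (k $ j))\<^sup>2 / (D $$ (j, j))\<^sup>2)"

(* Meaningful for Re s > dim_row D / 2, where the family is absolutely summable. *)
definition spectral_zeta_series :: "real mat \<Rightarrow> complex \<Rightarrow> complex" where
  "spectral_zeta_series D s =
     (\<Sum>\<^sub>\<infinity>k\<in>carrier_vec (dim_row D) - {0\<^sub>v (dim_row D)}.
        complex_of_real (laplace_eigenvalue D k) powr (- s))"

(* nicely_meromorphic_on, rather than meromorphic_on, excludes removable singularities and
   fixes the value 0 at poles, so that the continuation is unique as a total function. *)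
definition spectral_zeta :: "real mat \<Rightarrow> complex \<Rightarrow> complex" where
  "spectral_zeta D =
     (THE Z. Z nicely_meromorphic_on UNIV \<and>
        (\<forall>s. Re s > real (dim_row D) / 2 \<longrightarrow> Z s = spectral_zeta_series D s))"

(* The derivative at 0 is real, since the zeta function commutes with complex conjugation;
   Re only adjusts the type. *)
definition zeta_det :: "real mat \<Rightarrow> real" where
  "zeta_det D = Re (exp (- deriv (spectral_zeta D) 0))"

end

theory Submission
  imports
    Defs
    "HOL-Probability.Characteristic_Functions"
    "HOL-Real_Asymp.Real_Asymp"
begin

unbundle no vec_syntax

text \<open>For a torus with \<open>D = diag (q\<^sub>1, \<dots>, q\<^sub>n)\<close> of unit volume put \<open>a\<^sub>i = 1 / q\<^sub>i\<^sup>2\<close>,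
  \<open>\<theta> x = (\<Sum>k\<in>\<int>. exp (- \<pi> k\<^sup>2 x))\<close> and \<open>\<Theta> t = (\<Prod>i. \<theta> (a\<^sub>i t))\<close>.  The Mellin transform of \<open>\<Theta> - 1\<close> is
  \<open>(4 \<pi>)\<^sup>s \<Gamma>(s) \<zeta>(s)\<close>.  By Jacobi's identity \<open>\<theta> (1 / t) = \<surd>t \<theta> t\<close> the function \<open>\<Theta> t - t\<^sup>-\<^sup>n\<^sup>/\<^sup>2\<close> decays rapidly
  at 0, so splitting the integral at \<open>t = 1\<close> yields
  \<open>(4 \<pi>)\<^sup>s \<Gamma>(s) \<zeta>(s) = H(s) + 1 / (s - n/2) - 1 / s\<close> with \<open>H\<close> entire, whence
  \<open>\<zeta>'(0) = H(0) + ln (4 \<pi>) - \<gamma> - 2 / n\<close> and the determinant is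
  \<open>exp (2 / n + \<gamma> - ln (4 \<pi>) - H(0))\<close>.  Here \<open>H(0)\<close> is the integral of a nonnegative function which,
  for \<open>a\<^sub>i = 1\<close>, increases with \<open>n\<close>; and \<open>H(0) \<ge> c n\<close> for a constant \<open>c > 0\<close> and all \<open>a\<close> with product 1,
  since every \<open>a\<^sub>i \<le> 1\<close> contributes a fixed amount on \<open>t \<ge> 1\<close> and every \<open>a\<^sub>i \<ge> 1\<close> one on \<open>t \<le> 1\<close>.\<close>

section \<open>Interchanging sums and integrals\<close>

text \<open>Enumerating an infinite countable \<open>I\<close> reduces the claim to termwise
  integration of an ordinary series; absolute summability makes the sums independent of the
  enumeration.\<close>

lemma has_sum_integral:
  fixes f :: "'i \<Rightarrow> 'a \<Rightarrow> 'b::{banach, second_countable_topology}"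
  assumes "countable I"
    and int: "\<And>k. k \<in> I \<Longrightarrow> integrable M (f k)"
    and pw_sum: "\<And>x. x \<in> space M \<Longrightarrow> (\<lambda>k. norm (f k x)) summable_on I"
    and sum_norm: "(\<lambda>k. \<integral>x. norm (f k x) \<partial>M) summable_on I"
  shows "integrable M (\<lambda>x. \<Sum>\<^sub>\<infinity>k\<in>I. f k x)"
    and "((\<lambda>k. \<integral>x. f k x \<partial>M) has_sum (\<integral>x. (\<Sum>\<^sub>\<infinity>k\<in>I. f k x) \<partial>M)) I"
proof -
  have "integrable M (\<lambda>x. \<Sum>\<^sub>\<infinity>k\<in>I. f k x) \<and>
    ((\<lambda>k. \<integral>x. f k x \<partial>M) has_sum (\<integral>x. (\<Sum>\<^sub>\<infinity>k\<in>I. f k x) \<partial>M)) I"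
  proof (cases "finite I")
    case True
    with int show ?thesis
      by (auto simp: has_sum_finite_iff intro!: Bochner_Integration.integral_sum)
  next
    case False
    with \<open>countable I\<close> have bij: "bij_betw (from_nat_into I) UNIV I"
      by (rule bij_betw_from_nat_into)
    have mem: "from_nat_into I i \<in> I" for i
      using False by (metis finite.emptyI from_nat_into)
    define g where "g i = f (from_nat_into I i)" for i
    have g_int: "integrable M (g i)" for i
      unfolding g_def by (rule int[OF mem])
    have g_sum: "(\<lambda>i. norm (g i x)) summable_on UNIV" if "x \<in> space M" for x
      using pw_sum[OF that] unfolding g_def
      by (rule summable_on_reindex_bij_betw[OF bij, THEN iffD2])
    hence AE1: "AE x in M. summable (\<lambda>i. norm (g i x))"
      by (intro AE_I2 summable_on_imp_summable)
    have g_norm_on: "(\<lambda>i. \<integral>x. norm (g i x) \<partial>M) summable_on UNIV"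
      using sum_norm unfolding g_def
      by (subst summable_on_reindex_bij_betw[OF bij, where f="\<lambda>k. \<integral>x. norm (f k x) \<partial>M"])
    hence g_norm: "summable (\<lambda>i. \<integral>x. norm (g i x) \<partial>M)"
      by (rule summable_on_imp_summable)
    have eq: "(\<Sum>i. g i x) = (\<Sum>\<^sub>\<infinity>k\<in>I. f k x)" if "x \<in> space M" for x
    proof -
      have "(\<lambda>i. g i x) summable_on UNIV"
        using g_sum[OF that] by (rule abs_summable_summable)
      hence "((\<lambda>i. g i x) has_sum (\<Sum>\<^sub>\<infinity>i. g i x)) UNIV"
        by (rule has_sum_infsum)
      hence "(\<Sum>i. g i x) = (\<Sum>\<^sub>\<infinity>i. g i x)"
        using has_sum_imp_sums sums_unique by metis
      also have "\<dots> = (\<Sum>\<^sub>\<infinity>k\<in>I. f k x)"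
        unfolding g_def by (rule infsum_reindex_bij_betw[OF bij, where f="\<lambda>k. f k x"])
      finally show ?thesis .
    qed
    have "integrable M (\<lambda>x. \<Sum>i. g i x)"
      by (rule integrable_suminf[OF g_int AE1 g_norm])
    hence "integrable M (\<lambda>x. \<Sum>\<^sub>\<infinity>k\<in>I. f k x)"
      by (subst Bochner_Integration.integrable_cong[OF refl eq[symmetric]])
    moreover have "(\<lambda>i. norm (\<integral>x. g i x \<partial>M)) summable_on UNIV"
      by (rule summable_on_comparison_test[OF g_norm_on])
         (auto intro: integral_norm_bound)
    hence "(\<lambda>i. \<integral>x. g i x \<partial>M) summable_on UNIV"
      by (rule abs_summable_summable)
    hence "((\<lambda>i. \<integral>x. g i x \<partial>M) has_sum (\<Sum>\<^sub>\<infinity>i. \<integral>x. g i x \<partial>M)) UNIV"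
      by (rule has_sum_infsum)
    moreover from this have "(\<Sum>\<^sub>\<infinity>i. \<integral>x. g i x \<partial>M) = (\<integral>x. (\<Sum>i. g i x) \<partial>M)"
      using has_sum_imp_sums sums_integral[OF g_int AE1 g_norm] sums_unique2 by blast
    moreover have "\<dots> = (\<integral>x. (\<Sum>\<^sub>\<infinity>k\<in>I. f k x) \<partial>M)"
      by (rule Bochner_Integration.integral_cong[OF refl eq])
    ultimately show ?thesis
      using has_sum_reindex_bij_betw[OF bij, where f="\<lambda>k. \<integral>x. f k x \<partial>M"]
      by (simp add: g_def)
  qed
  thus "integrable M (\<lambda>x. \<Sum>\<^sub>\<infinity>k\<in>I. f k x)"
    and "((\<lambda>k. \<integral>x. f k x \<partial>M) has_sum (\<integral>x. (\<Sum>\<^sub>\<infinity>k\<in>I. f k x) \<partial>M)) I"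
    by blast+
qed

section \<open>Jacobi's theta identity\<close>

lemma summable_on_exp_abs_int:
  fixes c :: real
  assumes "c > 0"
  shows "(\<lambda>k::int. exp (- c * \<bar>of_int k\<bar>)) summable_on UNIV"
proof -
  have geo: "(\<lambda>n::nat. exp (- c * real n)) summable_on UNIV"
  proof -
    have "summable (\<lambda>n. exp (- c) ^ n)"
      using assms by (intro summable_geometric) auto
    also have "(\<lambda>n. exp (- c) ^ n) = (\<lambda>n::nat. exp (- c * real n))"
      by (rule ext, subst exp_of_nat_mult[symmetric]) (simp add: mult.commute)
    finally show ?thesis
      by (subst summable_on_UNIV_nonneg_real_iff) auto
  qed
  have "(\<lambda>k::int. exp (- c * \<bar>of_int k\<bar>)) summable_on range int"
    by (subst summable_on_reindex) (use geo in \<open>auto simp: o_def\<close>)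
  moreover have "(\<lambda>k::int. exp (- c * \<bar>of_int k\<bar>)) summable_on range (\<lambda>n. - int n)"
    by (subst summable_on_reindex) (use geo in \<open>auto simp: o_def inj_on_def\<close>)
  ultimately have "(\<lambda>k::int. exp (- c * \<bar>of_int k\<bar>)) summable_on range int \<union> range (\<lambda>n. - int n)"
    by (rule summable_on_union)
  moreover have "k \<in> range int \<union> range (\<lambda>n. - int n)" for k
    by (cases k rule: int_cases2) auto
  hence "range int \<union> range (\<lambda>n. - int n) = UNIV"
    by blast
  ultimately show ?thesis by simp
qed

lemma summable_on_gaussian_int:
  fixes c :: real
  assumes "c > 0"
  shows "(\<lambda>k::int. exp (- c * (of_int k)\<^sup>2)) summable_on UNIV"
proof (rule summable_on_comparison_test[OF summable_on_exp_abs_int[OF assms]])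
  fix k :: int
  have "\<bar>k\<bar> \<le> k\<^sup>2"
    using self_le_power[of "\<bar>k\<bar>" 2] by (cases "k = 0") auto
  hence "real_of_int \<bar>k\<bar> \<le> real_of_int (k\<^sup>2)"
    by (simp only: of_int_le_iff)
  thus "exp (- c * (of_int k)\<^sup>2) \<le> exp (- c * \<bar>of_int k\<bar>)"
    using assms by simp
qed auto

section \<open>Fourier integrals of Gaussians, periodization and cosine series\<close>

text \<open>The substitution \<open>x = c * y\<close>, with \<open>c\<close> squared equal to
  \<open>2 * pi * t\<close>, turns the Gaussian into a multiple of the standard normal density and
  the cosine into one of frequency \<open>u\<close>. The value then comes from the real part of the
  characteristic function \<open>exp (- u\<^sup>2 / 2)\<close>.\<close>

lemma gaussian_cos_integral:
  fixes t k :: real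
  assumes "t > 0"
  shows "has_bochner_integral lborel (\<lambda>y. exp (- pi * t * y\<^sup>2) * cos (2 * pi * k * y))
           (exp (- pi * k\<^sup>2 / t) / sqrt t)"
proof -
  define c where "c = sqrt (2 * pi * t)"
  have c: "c > 0" "c\<^sup>2 = 2 * pi * t" using assms by (auto simp: c_def)
  define u where "u = 2 * pi * k / c"
  define f where "f x = complex_of_real (std_normal_density x) * iexp (u * x)" for x
  have f_int: "integrable lborel f"
  proof (rule Bochner_Integration.integrable_bound[where f=std_normal_density])
    show "integrable lborel std_normal_density" by simp
    show "f \<in> borel_measurable lborel" unfolding f_def by measurable
  qed (auto simp: f_def norm_mult normal_density_nonneg)
  have f_val: "(\<integral>x. f x \<partial>lborel) = complex_of_real (exp (- u\<^sup>2 / 2))"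
  proof -
    have "char std_normal_distribution u = (\<integral>x. std_normal_density x *\<^sub>R iexp (u * x) \<partial>lborel)"
      unfolding char_def by (subst integral_density) (auto simp: normal_density_nonneg)
    also have "\<dots> = (\<integral>x. f x \<partial>lborel)"
      by (simp add: f_def scaleR_conv_of_real)
    finally show ?thesis by (simp add: char_std_normal_distribution)
  qed
  define g where "g x = Re (f x)" for x
  have g: "g x = 1 / sqrt (2 * pi) * exp (- x\<^sup>2 / 2) * cos (u * x)" for x
  proof -
    have "f x = complex_of_real (std_normal_density x) * cis (u * x)"
      by (simp add: f_def cis_conv_exp)
    thus ?thesis by (simp add: g_def std_normal_density_def)
  qed
  have g_int: "integrable lborel g" and g_val: "(\<integral>x. g x \<partial>lborel) = exp (- u\<^sup>2 / 2)"
    unfolding g_def using f_int f_val by (auto simp: integral_Re)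
  have eq: "exp (- pi * t * y\<^sup>2) * cos (2 * pi * k * y) = sqrt (2 * pi) * g (0 + c * y)" for y
  proof -
    have "- (c * y)\<^sup>2 / 2 = - pi * t * y\<^sup>2" using c by (simp add: power_mult_distrib)
    moreover have "u * (c * y) = 2 * pi * k * y" using c by (simp add: u_def)
    ultimately show ?thesis unfolding g by (simp only: add_0) simp
  qed
  have "u\<^sup>2 / 2 = pi * k\<^sup>2 / t"
    using c assms by (simp add: u_def power_divide power_mult_distrib) (simp add: power2_eq_square)
  hence u2: "- u\<^sup>2 / 2 = - pi * k\<^sup>2 / t"
    by simp
  have "\<bar>c\<bar> *\<^sub>R (\<integral>y. g (0 + c * y) \<partial>lborel) = exp (- pi * k\<^sup>2 / t)"
    unfolding g_val[unfolded u2, symmetric]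
    by (rule lborel_integral_real_affine[symmetric]) (use c in auto)
  hence *: "(\<integral>y. g (0 + c * y) \<partial>lborel) = exp (- pi * k\<^sup>2 / t) / c"
    using c(1) by (simp add: nonzero_eq_divide_eq mult.commute[of c])
  have "sqrt (2 * pi) / c = 1 / sqrt t"
    using assms by (simp add: c_def real_sqrt_mult)
  hence "(\<integral>y. sqrt (2 * pi) * g (0 + c * y) \<partial>lborel) = exp (- pi * k\<^sup>2 / t) / sqrt t"
    by (simp only: integral_mult_right_zero *) (metis mult.commute times_divide_eq_right mult_1)
  moreover have "integrable lborel (\<lambda>y. sqrt (2 * pi) * g (0 + c * y))"
    using lborel_integrable_real_affine[OF g_int, of c 0] c by auto
  ultimately show ?thesis
    by (simp only: eq has_bochner_integral_iff)
qed

text \<open>First half of Poisson summation. The line is cut into unit intervals starting at the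
  integers (\<open>f m\<close>), and each piece is moved to \<open>[0, 1)\<close>
  (\<open>h m\<close>) without changing its integral. Sum and integral may be exchanged because the
  norms of finitely many pieces add up to at most the norm of \<open>g\<close>.\<close>

lemma integral_periodization:
  fixes g :: "real \<Rightarrow> real"
  assumes g: "integrable lborel g"
    and summable: "\<And>x. 0 \<le> x \<Longrightarrow> x < 1 \<Longrightarrow> (\<lambda>m::int. norm (g (x + of_int m))) summable_on UNIV"
  shows "(\<integral>x. indicator {0..<1} x * (\<Sum>\<^sub>\<infinity>m::int. g (x + of_int m)) \<partial>lborel) = (\<integral>x. g x \<partial>lborel)"
proof -
  define f where "f m y = indicator {of_int m..<of_int m + 1} y * g y" for m :: int and y
  define h where "h m x = indicator {0..<1} x * g (x + of_int m)" for m :: int and x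
  have f_int: "integrable lborel (f m)" for m
    unfolding f_def using integrable_real_mult_indicator[OF _ g]
    by (simp add: mult.commute)
  have fh: "f m (of_int m + 1 * x) = h m x" for m x
    by (auto simp: f_def h_def indicator_def add.commute)
  have h_int: "integrable lborel (h m)" for m
    using lborel_integrable_real_affine[OF f_int[of m], of 1 "of_int m"] by (simp only: fh not_False_eq_True one_neq_zero)
  have h_val: "(\<integral>x. h m x \<partial>lborel) = (\<integral>y. f m y \<partial>lborel)" for m
    using lborel_integral_real_affine[of 1 "f m" "of_int m"] by (simp only: fh) simp
  have h_norm: "(\<integral>x. norm (h m x) \<partial>lborel) = (\<integral>y. norm (f m y) \<partial>lborel)" for m
    using lborel_integral_real_affine[of 1 "\<lambda>y. norm (f m y)" "of_int m"] by (simp only: fh) simp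
  \<comment> \<open>The half-open intervals are disjoint and cover the line, so at each
    \<open>y\<close> all sums over \<open>m\<close> collapse to a single term.\<close>
  have f_supp: "f m y = (if m = \<lfloor>y\<rfloor> then g y else 0)" for m y
    by (auto simp: f_def indicator_def) linarith+
  have f_norm_has_sum: "((\<lambda>m. norm (f m y)) has_sum norm (g y)) UNIV" for y
    by (rule has_sum_finite_neutralI[of "{\<lfloor>y\<rfloor>}"]) (auto simp: f_supp)
  have f_has_sum: "((\<lambda>m. f m y) has_sum g y) UNIV" for y
    by (rule has_sum_finite_neutralI[of "{\<lfloor>y\<rfloor>}"]) (auto simp: f_supp)
  have f_norms: "(\<lambda>m. \<integral>y. norm (f m y) \<partial>lborel) summable_on UNIV"
  proof (rule nonneg_bdd_above_summable_on)
    show "bdd_above (sum (\<lambda>m. \<integral>y. norm (f m y) \<partial>lborel) ` {F. F \<subseteq> UNIV \<and> finite F})"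
    proof (rule bdd_aboveI2, clarify)
      fix F :: "int set" assume F: "finite F"
      have "(\<Sum>m\<in>F. \<integral>y. norm (f m y) \<partial>lborel) = (\<integral>y. (\<Sum>m\<in>F. norm (f m y)) \<partial>lborel)"
        using f_int by (intro Bochner_Integration.integral_sum[symmetric]) auto
      also have "\<dots> \<le> (\<integral>y. norm (g y) \<partial>lborel)"
      proof (rule integral_mono)
        fix y
        show "(\<Sum>m\<in>F. norm (f m y)) \<le> norm (g y)"
          using F by (auto simp: f_supp if_distrib sum.delta cong: if_cong)
      qed (use f_int g in auto)
      finally show "(\<Sum>m\<in>F. \<integral>y. norm (f m y) \<partial>lborel) \<le> (\<integral>y. norm (g y) \<partial>lborel)" .
    qed
  qed auto
  have "((\<lambda>m. \<integral>y. f m y \<partial>lborel) has_sum (\<integral>y. (\<Sum>\<^sub>\<infinity>m. f m y) \<partial>lborel)) UNIV"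
    by (rule has_sum_integral) (use f_int f_norms f_norm_has_sum in \<open>auto intro: has_sum_imp_summable\<close>)
  also have "(\<lambda>y. \<Sum>\<^sub>\<infinity>m. f m y) = g"
    using f_has_sum by (auto intro: infsumI)
  finally have sum_f: "((\<lambda>m. \<integral>y. f m y \<partial>lborel) has_sum (\<integral>y. g y \<partial>lborel)) UNIV" .
  have h_pw: "(\<lambda>m. norm (h m x)) summable_on UNIV" for x
    using summable[of x] by (auto simp: h_def indicator_def)
  have "((\<lambda>m. \<integral>x. h m x \<partial>lborel) has_sum (\<integral>x. (\<Sum>\<^sub>\<infinity>m. h m x) \<partial>lborel)) UNIV"
    by (rule has_sum_integral) (use h_int h_pw f_norms in \<open>auto simp: h_norm simp del: real_norm_def\<close>)
  hence "(\<integral>x. (\<Sum>\<^sub>\<infinity>m. h m x) \<partial>lborel) = (\<integral>y. g y \<partial>lborel)"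
    using sum_f by (simp add: h_val has_sum_unique)
  moreover have "(\<Sum>\<^sub>\<infinity>m. h m x) = indicator {0..<1} x * (\<Sum>\<^sub>\<infinity>m::int. g (x + of_int m))" for x
    by (auto simp: h_def indicator_def)
  ultimately show ?thesis by simp
qed

lemma lborel_integral_Ico_eq_integral:
  fixes f :: "real \<Rightarrow> real"
  assumes "continuous_on {a..b} f"
  shows "(\<integral>x. indicator {a..<b} x * f x \<partial>lborel) = integral {a..b} f"
proof -
  have f: "set_integrable lborel {a..b} f"
    by (rule borel_integrable_atLeastAtMost'[OF assms])
  have ae: "AE x in lborel. indicator {a..<b} x * f x = indicator {a..b} x * f x"
    using AE_lborel_singleton[of b] by eventually_elim (auto simp: indicator_def)
  have "set_integrable lborel {a..<b} f"
    using f by (rule set_integrable_subset) auto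
  hence "(\<integral>x. indicator {a..<b} x * f x \<partial>lborel) = (\<integral>x. indicator {a..b} x * f x \<partial>lborel)"
    using f by (intro integral_cong_AE ae) (auto simp: set_integrable_def dest: borel_measurable_integrable)
  thus ?thesis
    using set_borel_integral_eq_integral(2)[OF f] by (simp add: set_lebesgue_integral_def)
qed

lemma integral_cos_2pi_int:
  fixes j :: int
  shows "integral {0..1} (\<lambda>x. cos (2 * pi * of_int j * x)) = (if j = 0 then 1 else 0)"
proof (cases "j = 0")
  case False
  have "((\<lambda>x. cos (2 * pi * of_int j * x)) has_integral
          sin (2 * pi * of_int j * 1) / (2 * pi * of_int j) - sin (2 * pi * of_int j * 0) / (2 * pi * of_int j)) {0..1}"
    by (rule fundamental_theorem_of_calculus)
       (use False in \<open>auto intro!: derivative_eq_intros simp flip: has_real_derivative_iff_has_vector_derivative\<close>)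
  moreover have "sin (2 * pi * of_int j) = 0"
    by (metis mult.commute sin_integer_2pi Ints_of_int)
  ultimately show ?thesis using False by (auto simp: integral_unique)
qed auto

text \<open>Absolute summability gives uniform convergence, hence continuity, and permits termwise
  integration against the cosine of frequency \<open>m\<close>. As \<open>k\<close> runs over all
  integers, both \<open>k = m\<close> and \<open>k = - m\<close> survive, each with weight one half;
  evenness of \<open>c\<close> joins them into \<open>c m\<close>.\<close>

lemma cos_coeff_cos_series:
  fixes c :: "int \<Rightarrow> real"
  assumes c: "(\<lambda>k. norm (c k)) summable_on UNIV" and even: "\<And>k. c (- k) = c k"
  shows "continuous_on A (\<lambda>x. \<Sum>\<^sub>\<infinity>k. c k * cos (2 * pi * of_int k * x))"
    and "integral {0..1} (\<lambda>x. (\<Sum>\<^sub>\<infinity>k. c k * cos (2 * pi * of_int k * x)) * cos (2 * pi * of_int m * x)) = c m"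
proof -
  define f where "f k x = c k * cos (2 * pi * of_int k * x)" for k :: int and x
  have f_le: "norm (f k x) \<le> norm (c k)" for k x
    by (auto simp: f_def abs_mult intro!: mult_left_le abs_cos_le_one)
  have f_sum: "(\<lambda>k. f k x) summable_on UNIV" for x
    by (rule abs_summable_summable, rule summable_on_comparison_test[OF c]) (use f_le in auto)
  have cont: "continuous_on A (\<lambda>x. \<Sum>\<^sub>\<infinity>k. f k x)" for A
  proof (rule uniform_limit_theorem)
    show "uniform_limit A (\<lambda>X y. \<Sum>x\<in>X. f x y) (\<lambda>y. \<Sum>\<^sub>\<infinity>x. f x y) (finite_subsets_at_top UNIV)"
      by (rule Weierstrass_m_test_general[OF f_le c])
  qed (auto simp: f_def intro!: always_eventually continuous_intros)
  thus "continuous_on A (\<lambda>x. \<Sum>\<^sub>\<infinity>k. c k * cos (2 * pi * of_int k * x))" by (simp add: f_def)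

  define w where "w x = cos (2 * pi * of_int m * x)" for x
  define h where "h k x = indicator {0..<1} x * (f k x * w x)" for k x
  have fw_cont: "continuous_on {0..1} (\<lambda>x. f k x * w x)" for k
    unfolding f_def w_def by (intro continuous_intros)
  have h_int: "integrable lborel (h k)" for k
  proof -
    have "set_integrable lborel {0..<1} (\<lambda>x. f k x * w x)"
      by (rule set_integrable_subset[OF borel_integrable_atLeastAtMost'[OF fw_cont]]) auto
    thus ?thesis by (simp add: set_integrable_def h_def[abs_def])
  qed
  have h_le: "norm (h k x) \<le> indicator {0..<1} x * norm (c k)" for k x
  proof -
    have "norm (f k x * w x) \<le> norm (c k) * 1"
      unfolding norm_mult by (intro mult_mono f_le) (auto simp: w_def)
    thus ?thesis by (auto simp: h_def indicator_def)
  qed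
  have h_pw: "(\<lambda>k. norm (h k x)) summable_on UNIV" for x
    by (rule summable_on_comparison_test[OF c])
       (rule order_trans[OF h_le], auto simp: indicator_def)
  have h_norm: "(\<integral>x. norm (h k x) \<partial>lborel) \<le> norm (c k)" for k
  proof -
    have "(\<integral>x. norm (h k x) \<partial>lborel) \<le> (\<integral>x. indicator {0..<1::real} x * norm (c k) \<partial>lborel)"
      by (intro integral_mono h_le integrable_norm h_int) auto
    thus ?thesis by simp
  qed
  have "((\<lambda>k. \<integral>x. h k x \<partial>lborel) has_sum (\<integral>x. (\<Sum>\<^sub>\<infinity>k. h k x) \<partial>lborel)) UNIV"
  proof (rule has_sum_integral)
    show "(\<lambda>k. \<integral>x. norm (h k x) \<partial>lborel) summable_on UNIV"
      by (rule summable_on_comparison_test[OF c]) (use h_norm in auto)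
  qed (use h_int h_pw in auto)
  moreover have "(\<Sum>\<^sub>\<infinity>k. h k x) = indicator {0..<1} x * ((\<Sum>\<^sub>\<infinity>k. f k x) * w x)" for x
    by (simp add: h_def infsum_cmult_right' infsum_cmult_left')
  moreover have "(\<integral>x. indicator {0..<1} x * ((\<Sum>\<^sub>\<infinity>k. f k x) * w x) \<partial>lborel)
      = integral {0..1} (\<lambda>x. (\<Sum>\<^sub>\<infinity>k. f k x) * w x)"
    by (intro lborel_integral_Ico_eq_integral continuous_intros cont) (auto simp: w_def intro!: continuous_intros)
  \<comment> \<open>The two indicator terms come from the product-to-sum formula; for
    \<open>m = 0\<close> they coincide, and their sum 2 cancels the denominator.\<close>
  moreover have "(\<integral>x. h k x \<partial>lborel) = c k * ((if k = m then 1 else 0) + (if k = - m then 1 else 0)) / 2" for k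
  proof -
    have "(\<integral>x. h k x \<partial>lborel) = integral {0..1} (\<lambda>x. f k x * w x)"
      unfolding h_def by (rule lborel_integral_Ico_eq_integral[OF fw_cont])
    also have "(\<lambda>x. f k x * w x) = (\<lambda>x. c k / 2 * (cos (2 * pi * of_int (k - m) * x) + cos (2 * pi * of_int (k + m) * x)))"
      by (simp add: f_def w_def fun_eq_iff cos_times_cos algebra_simps)
    also have "integral {0..1} \<dots> = c k / 2 * (integral {0..1} (\<lambda>x. cos (2 * pi * of_int (k - m) * x))
                  + integral {0..1} (\<lambda>x. cos (2 * pi * of_int (k + m) * x)))"
      by (subst integral_mult_right, subst integral_add)
         (auto intro!: integrable_continuous_real continuous_intros)
    finally show ?thesis
      by (simp only: integral_cos_2pi_int) (auto simp: eq_neg_iff_add_eq_0)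
  qed
  ultimately have sum1: "((\<lambda>k. c k * ((if k = m then 1 else 0) + (if k = - m then 1 else 0)) / 2)
     has_sum integral {0..1} (\<lambda>x. (\<Sum>\<^sub>\<infinity>k. f k x) * w x)) UNIV"
    by simp
  have "((\<lambda>k. c k * ((if k = m then 1 else 0) + (if k = - m then 1 else 0)) / 2) has_sum c m) UNIV"
    by (cases "m = 0"; rule has_sum_finite_neutralI[of "{m, -m}"]) (auto simp: even)
  from has_sum_unique[OF sum1 this]
  show "integral {0..1} (\<lambda>x. (\<Sum>\<^sub>\<infinity>k. c k * cos (2 * pi * of_int k * x)) * cos (2 * pi * of_int m * x)) = c m"
    by (simp add: f_def w_def)
qed

text \<open>By symmetry \<open>H\<close> is a continuous function of \<open>cos (2 * pi * x)\<close>, so Weierstrass' theorem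
  approximates it by polynomials in \<open>cos (2 * pi * x)\<close>, all of which are orthogonal to \<open>H\<close>.\<close>

lemma zero_if_cos_coeffs_zero:
  fixes H :: "real \<Rightarrow> real"
  assumes cont: "continuous_on {0..1} H"
    and sym: "\<And>x. x \<in> {0..1} \<Longrightarrow> H (1 - x) = H x"
    and coeffs: "\<And>m::int. integral {0..1} (\<lambda>x. H x * cos (2 * pi * of_int m * x)) = 0"
    and x: "x \<in> {0..1}"
  shows "H x = 0"
proof -
  define C where "C x = cos (2 * pi * x)" for x :: real
  have C_cont: "continuous_on A C" for A
    unfolding C_def by (intro continuous_intros)
  \<comment> \<open>The frequency \<open>m\<close> stays arbitrary in the induction: by the
    product-to-sum formula a further factor \<open>C x\<close> shifts it to \<open>m - 1\<close> and
    \<open>m + 1\<close>.\<close>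
  have powers: "integral {0..1} (\<lambda>x. H x * cos (2 * pi * of_int m * x) * C x ^ i) = 0" for m :: int and i
  proof (induction i arbitrary: m)
    case 0
    thus ?case using coeffs by simp
  next
    case (Suc i)
    have int: "(\<lambda>x. H x * cos (2 * pi * of_int l * x) * C x ^ i) integrable_on {0..1}" for l :: int
      by (intro integrable_continuous_real continuous_intros cont C_cont)
    have "H x * cos (2 * pi * of_int m * x) * C x ^ Suc i
       = 1/2 * (H x * cos (2 * pi * of_int (m - 1) * x) * C x ^ i + H x * cos (2 * pi * of_int (m + 1) * x) * C x ^ i)" for x
    proof -
      have "2 * pi * of_int m * x - 2 * pi * x = 2 * pi * of_int (m - 1) * x"
        "2 * pi * of_int m * x + 2 * pi * x = 2 * pi * of_int (m + 1) * x"
        by (simp_all add: algebra_simps)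
      hence "cos (2 * pi * of_int m * x) * C x = 1/2 * (cos (2 * pi * of_int (m - 1) * x) + cos (2 * pi * of_int (m + 1) * x))"
        by (simp add: C_def cos_times_cos)
      moreover have "H x * cos (2 * pi * of_int m * x) * C x ^ Suc i
          = H x * (cos (2 * pi * of_int m * x) * C x) * C x ^ i"
        by (simp only: power_Suc mult_ac)
      ultimately show ?thesis by (simp only: distrib_left distrib_right mult_ac)
    qed
    thus ?case
      by (simp only:) (subst integral_mult_right, subst integral_add[OF int int], simp only: Suc.IH, simp)
  qed
  have poly: "integral {0..1} (\<lambda>x. H x * (\<Sum>i\<le>n. a i * C x ^ i)) = 0" for a :: "nat \<Rightarrow> real" and n
  proof -
    have *: "(\<lambda>x. H x * (\<Sum>i\<le>n. a i * C x ^ i)) = (\<lambda>x. \<Sum>i\<le>n. a i * (H x * cos (2 * pi * of_int 0 * x) * C x ^ i))"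
      by (simp add: sum_distrib_left algebra_simps)
    have "integral {0..1} (\<lambda>x. H x * (\<Sum>i\<le>n. a i * C x ^ i)) = (\<Sum>i\<le>n. integral {0..1} (\<lambda>x. a i * (H x * cos (2 * pi * of_int 0 * x) * C x ^ i)))"
      unfolding * by (intro integral_sum integrable_continuous_real continuous_intros cont C_cont) auto
    also have "\<dots> = 0"
      by (simp only: integral_mult_right powers) simp
    finally show ?thesis .
  qed
  \<comment> \<open>\<open>h\<close> is \<open>H\<close> as a function of the cosine.
    \<open>arccos\<close> recovers \<open>2 * pi * x\<close> from \<open>C x\<close> only on
    \<open>[0, 1/2]\<close>; the symmetry of \<open>H\<close> takes care of the other half.\<close>
  define h where "h u = H (arccos u / (2 * pi))" for u
  have h_cont: "continuous_on {-1..1} h"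
    unfolding h_def
  proof (rule continuous_on_compose2[OF cont])
    show "continuous_on {-1..1} (\<lambda>u. arccos u / (2 * pi))"
      by (intro continuous_intros continuous_on_arccos') auto
    show "(\<lambda>u. arccos u / (2 * pi)) ` {-1..1} \<subseteq> {0..1}"
    proof (intro image_subsetI)
      fix u :: real assume "u \<in> {-1..1}"
      hence "0 \<le> arccos u" "arccos u \<le> pi" by (auto intro: arccos_lbound arccos_ubound)
      thus "arccos u / (2 * pi) \<in> {0..1}" by (auto simp: field_simps)
    qed
  qed
  have hC: "h (C x) = H x" if "x \<in> {0..1}" for x
  proof (cases "x \<le> 1 / 2")
    case True
    with that have "arccos (C x) = 2 * pi * x"
      unfolding C_def by (intro arccos_cos) (auto simp: field_simps)
    thus ?thesis by (simp add: h_def)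
  next
    case False
    have "C x = cos (2 * pi * (1 - x))"
      by (simp add: C_def algebra_simps cos_diff)
    moreover have "arccos (cos (2 * pi * (1 - x))) = 2 * pi * (1 - x)"
      using that False by (intro arccos_cos) (auto simp: field_simps)
    ultimately show ?thesis using sym[OF that] by (simp add: h_def)
  qed
  have HH: "(\<lambda>x. H x * H x) integrable_on {0..1}" "(\<lambda>x. \<bar>H x\<bar>) integrable_on {0..1}"
    by (auto intro!: integrable_continuous_real continuous_intros cont)
  define J where "J = integral {0..1} (\<lambda>x. \<bar>H x\<bar>)"
  have J: "J \<ge> 0" unfolding J_def by (rule Henstock_Kurzweil_Integration.integral_nonneg[OF HH(2)]) auto
  \<comment> \<open>Since \<open>H\<close> is orthogonal to \<open>p (C x)\<close>, the integral of
    its square equals that of \<open>H x * (H x - p (C x))\<close>, whose second factor is at most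
    \<open>e\<close> in modulus.\<close>
  have small: "integral {0..1} (\<lambda>x. H x * H x) \<le> e * J" if "e > 0" for e
  proof -
    obtain p where p: "real_polynomial_function p" "\<And>u. u \<in> {-1..1} \<Longrightarrow> \<bar>h u - p u\<bar> < e"
      using Stone_Weierstrass_real_polynomial_function[OF compact_Icc h_cont \<open>e > 0\<close>] by blast
    then obtain a n where p_eq: "p = (\<lambda>x. \<Sum>i\<le>n. a i * x ^ i)"
      by (auto simp: real_polynomial_function_iff_sum)
    have int: "(\<lambda>x. H x * p (C x)) integrable_on {0..1}"
      unfolding p_eq by (intro integrable_continuous_real continuous_intros cont C_cont)
    have "integral {0..1} (\<lambda>x. H x * H x) = integral {0..1} (\<lambda>x. H x * H x) - integral {0..1} (\<lambda>x. H x * p (C x))"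
      unfolding p_eq poly by simp
    also have "\<dots> = integral {0..1} (\<lambda>x. H x * H x - H x * p (C x))"
      by (rule Henstock_Kurzweil_Integration.integral_diff[OF HH(1) int, symmetric])
    also have "\<dots> \<le> integral {0..1} (\<lambda>x. e * \<bar>H x\<bar>)"
    proof (rule integral_le)
      fix x :: real assume x: "x \<in> {0..1}"
      have "C x \<in> {-1..1}" by (auto simp: C_def)
      hence "\<bar>H x - p (C x)\<bar> \<le> e" using p(2) hC[OF x] by (metis less_imp_le)
      hence "\<bar>H x\<bar> * \<bar>H x - p (C x)\<bar> \<le> \<bar>H x\<bar> * e" by (intro mult_left_mono) auto
      moreover have "H x * H x - H x * p (C x) \<le> \<bar>H x\<bar> * \<bar>H x - p (C x)\<bar>"
        by (metis abs_ge_self abs_mult right_diff_distrib)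
      ultimately show "H x * H x - H x * p (C x) \<le> e * \<bar>H x\<bar>" by (simp add: mult.commute)
    next
      show "(\<lambda>x. H x * H x - H x * p (C x)) integrable_on {0..1}"
        by (rule Henstock_Kurzweil_Integration.integrable_diff[OF HH(1) int])
      show "(\<lambda>x. e * \<bar>H x\<bar>) integrable_on {0..1}"
        by (intro integrable_continuous_real continuous_intros cont)
    qed
    finally show ?thesis by (simp add: J_def)
  qed
  have "integral {0..1} (\<lambda>x. H x * H x) \<le> 0"
  proof (rule field_le_epsilon)
    fix e :: real assume "e > 0"
    \<comment> \<open>Dividing by \<open>J + 1\<close> instead of \<open>J\<close> covers the case
      \<open>J = 0\<close>.\<close>
    have "integral {0..1} (\<lambda>x. H x * H x) \<le> e / (J + 1) * J"
      by (rule small) (use J \<open>e > 0\<close> in auto)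
    also have "\<dots> \<le> e" using J \<open>e > 0\<close> by (simp add: field_simps)
    finally show "integral {0..1} (\<lambda>x. H x * H x) \<le> 0 + e" by simp
  qed
  moreover have "integral {0..1} (\<lambda>x. H x * H x) \<ge> 0"
    by (rule Henstock_Kurzweil_Integration.integral_nonneg[OF HH(1)]) auto
  ultimately have "integral {0..1} (\<lambda>x. H x * H x) = 0" by simp
  moreover have "continuous_on {0..1} (\<lambda>x. H x * H x)" by (intro continuous_intros cont)
  ultimately have "\<forall>x\<in>{0..1}. H x * H x = 0"
    using integral_eq_0_iff[of 0 1 "\<lambda>x. H x * H x"] by auto
  thus ?thesis using x by auto
qed

section \<open>The one-dimensional theta function\<close>

definition theta :: "real \<Rightarrow> real" where
  "theta x = (\<Sum>\<^sub>\<infinity>k::int. exp (- pi * x * (of_int k)\<^sup>2))"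

lemma theta_summable:
  assumes "x > 0"
  shows "(\<lambda>k::int. exp (- pi * x * (of_int k)\<^sup>2)) summable_on UNIV"
  using summable_on_gaussian_int[of "pi * x"] assms by simp

text \<open>Poisson summation for the Gaussian \<open>g\<close>. Its periodization \<open>F\<close>
  and the cosine series \<open>G\<close> built from its Fourier transform are continuous, symmetric
  under \<open>x -> 1 - x\<close> and have the same cosine coefficients, hence agree on
  \<open>[0, 1]\<close>. Evaluation at 0 gives the identity.\<close>

lemma theta_inverse:
  assumes t: "t > 0"
  shows "theta (1 / t) = sqrt t * theta t"
proof -
  define g where "g y = exp (- pi * t * y\<^sup>2)" for y :: real
  define F where "F x = (\<Sum>\<^sub>\<infinity>m::int. g (x + of_int m))" for x
  define c where "c k = exp (- pi * (of_int k)\<^sup>2 / t) / sqrt t" for k :: int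
  define G where "G x = (\<Sum>\<^sub>\<infinity>k. c k * cos (2 * pi * of_int k * x))" for x
  \<comment> \<open>A summable majorant uniform in \<open>x\<close>: from
    \<open>(2 * x + m)\<^sup>2 >= 0\<close> and \<open>x\<^sup>2 <= 1\<close> follows
    \<open>(x + m)\<^sup>2 >= m\<^sup>2 / 2 - 1\<close>.\<close>
  define B where "B m = exp (pi * t) * exp (- (pi * t / 2) * (of_int m)\<^sup>2)" for m :: int
  have B_sum: "B summable_on UNIV"
    unfolding B_def using t by (intro summable_on_cmult_right summable_on_gaussian_int) auto
  have g_le: "norm (g (x + of_int m)) \<le> B m" if "x \<in> {0..1}" for x m
  proof -
    have "x\<^sup>2 \<le> 1" using that by (auto simp: abs_square_le_1)
    moreover have "0 \<le> (2 * x + of_int m)\<^sup>2" by simp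
    ultimately have "(of_int m)\<^sup>2 / 2 - 1 \<le> (x + of_int m)\<^sup>2"
      by (simp add: power2_eq_square algebra_simps)
    hence "pi * t * ((of_int m)\<^sup>2 / 2 - 1) \<le> pi * t * (x + of_int m)\<^sup>2"
      using t by (intro mult_left_mono) auto
    thus ?thesis by (simp add: g_def B_def algebra_simps flip: exp_add)
  qed
  have g_sum: "(\<lambda>m. norm (g (x + of_int m))) summable_on UNIV" if "x \<in> {0..1}" for x
    by (rule summable_on_comparison_test[OF B_sum]) (use g_le that in auto)
  have F_cont: "continuous_on {0..1} F"
    unfolding F_def
  proof (rule uniform_limit_theorem)
    show "uniform_limit {0..1} (\<lambda>X y. \<Sum>m\<in>X. g (y + of_int m)) (\<lambda>y. \<Sum>\<^sub>\<infinity>m::int. g (y + of_int m))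
            (finite_subsets_at_top UNIV)"
      by (rule Weierstrass_m_test_general[OF g_le B_sum])
  qed (auto simp: g_def intro!: always_eventually continuous_intros)
  have F_sym: "F (1 - x) = F x" for x
  proof -
    have "bij_betw (\<lambda>m::int. - m - 1) UNIV UNIV"
      by (rule bij_betwI[where g="\<lambda>m. - m - 1"]) auto
    hence "F x = (\<Sum>\<^sub>\<infinity>m::int. g (x + of_int (- m - 1)))"
      unfolding F_def by (rule infsum_reindex_bij_betw[symmetric])
    also have "(\<lambda>m::int. g (x + of_int (- m - 1))) = (\<lambda>m. g (1 - x + of_int m))"
      unfolding g_def by (simp add: power2_eq_square algebra_simps)
    finally show ?thesis by (simp add: F_def)
  qed
  have F_coeff: "integral {0..1} (\<lambda>x. F x * cos (2 * pi * of_int k * x)) = c k" for k :: int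
  proof -
    define w where "w y = g y * cos (2 * pi * of_int k * y)" for y
    have w: "has_bochner_integral lborel w (c k)"
      unfolding w_def g_def c_def by (rule gaussian_cos_integral[OF t])
    \<comment> \<open>The cosine has period 1, so \<open>F\<close> times the cosine is the
      periodization of \<open>w\<close>, and its coefficient becomes an integral of \<open>w\<close>
      over the whole line.\<close>
    have shift: "w (x + of_int m) = g (x + of_int m) * cos (2 * pi * of_int k * x)" for x m
    proof -
      have "2 * pi * of_int k * (x + of_int m) = 2 * pi * of_int k * x + 2 * pi * of_int (k * m)"
        by (simp add: algebra_simps)
      moreover have "cos (2 * pi * of_int (k * m)) = 1" "sin (2 * pi * of_int (k * m)) = 0"
        using cos_int_2pin[of "k * m"] sin_int_2pin[of "k * m"] by (simp_all only: mult_ac)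
      ultimately show ?thesis by (simp only: w_def cos_add) simp
    qed
    have "(\<integral>x. indicator {0..<1} x * (\<Sum>\<^sub>\<infinity>m::int. w (x + of_int m)) \<partial>lborel) = (\<integral>x. w x \<partial>lborel)"
    proof (rule integral_periodization)
      fix x :: real assume x: "0 \<le> x" "x < 1"
      show "(\<lambda>m. norm (w (x + of_int m))) summable_on UNIV"
        by (rule summable_on_comparison_test[OF g_sum[of x]])
           (use x in \<open>auto simp: shift norm_mult abs_mult intro!: mult_left_le abs_cos_le_one\<close>)
    qed (use w in \<open>auto simp: has_bochner_integral_iff\<close>)
    also have "(\<lambda>x. \<Sum>\<^sub>\<infinity>m::int. w (x + of_int m)) = (\<lambda>x. F x * cos (2 * pi * of_int k * x))"
      unfolding shift F_def by (simp add: infsum_cmult_left')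
    also have "(\<integral>x. indicator {0..<1} x * (F x * cos (2 * pi * of_int k * x)) \<partial>lborel)
        = integral {0..1} (\<lambda>x. F x * cos (2 * pi * of_int k * x))"
      by (intro lborel_integral_Ico_eq_integral continuous_intros F_cont)
    finally show ?thesis using w by (simp add: has_bochner_integral_iff)
  qed
  have c_sum: "(\<lambda>k. norm (c k)) summable_on UNIV"
    using summable_on_cmult_left[OF summable_on_gaussian_int[of "pi / t"], of "1 / sqrt t"] t
    by (simp add: c_def)
  have c_even: "c (- k) = c k" for k
    by (simp add: c_def)
  note G_cont = cos_coeff_cos_series(1)[OF c_sum c_even, folded G_def]
  note G_coeff = cos_coeff_cos_series(2)[OF c_sum c_even, folded G_def]
  have "F 0 - G 0 = 0"
  proof (rule zero_if_cos_coeffs_zero[where H = "\<lambda>x. F x - G x"])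
    show "continuous_on {0..1} (\<lambda>x. F x - G x)"
      by (intro continuous_intros F_cont G_cont)
    show "F (1 - x) - G (1 - x) = F x - G x" for x
    proof -
      have "cos (2 * pi * of_int k * (1 - x)) = cos (2 * pi * of_int k * x)" for k :: int
      proof -
        have "2 * pi * of_int k * (1 - x) = 2 * pi * of_int k - 2 * pi * of_int k * x"
          by (simp add: algebra_simps)
        thus ?thesis
          using cos_int_2pin[of k] sin_int_2pin[of k] by (simp add: cos_diff)
      qed
      thus ?thesis by (simp add: F_sym G_def)
    qed
    show "integral {0..1} (\<lambda>x. (F x - G x) * cos (2 * pi * of_int m * x)) = 0" for m :: int
      by (simp only: left_diff_distrib, subst Henstock_Kurzweil_Integration.integral_diff)
         (auto simp: F_coeff G_coeff intro!: integrable_continuous_real continuous_intros F_cont G_cont)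
  qed auto
  moreover have "F 0 = theta t"
    by (simp add: F_def theta_def g_def)
  moreover have "G 0 = theta (1 / t) / sqrt t"
    by (simp add: G_def theta_def c_def divide_inverse infsum_cmult_left' infsum_cmult_right' mult_ac)
  ultimately show ?thesis using t by (simp add: field_simps)
qed

lemma theta_antimono:
  assumes "0 < x" "x \<le> y"
  shows "theta y \<le> theta x"
  unfolding theta_def
proof (rule infsum_mono)
  fix k :: int
  have "pi * x * (of_int k)\<^sup>2 \<le> pi * y * (of_int k)\<^sup>2"
    using assms by (intro mult_right_mono mult_left_mono) auto
  thus "exp (- pi * y * (of_int k)\<^sup>2) \<le> exp (- pi * x * (of_int k)\<^sup>2)" by simp
qed (use assms theta_summable in auto)

lemma theta_ge:
  assumes "x > 0"
  shows "theta x \<ge> 1 + 2 * exp (- pi * x)"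
proof -
  have "(\<Sum>k\<in>{-1,0,1::int}. exp (- pi * x * (of_int k)\<^sup>2)) \<le> theta x"
    unfolding theta_def by (rule finite_sum_le_infsum) (use theta_summable[OF assms] in auto)
  thus ?thesis by simp
qed

section \<open>Analytic continuation and Mellin integrals\<close>

text \<open>Expanding the exponential and integrating termwise exhibits the integral as an
  everywhere convergent power series in \<open>s\<close>. The hypothesis with
  \<open>R = norm s\<close> supplies the integrable majorant of all partial sums.\<close>

lemma analytic_integral_exp:
  fixes f g :: "'a \<Rightarrow> real"
  assumes [measurable]: "f \<in> borel_measurable M" "g \<in> borel_measurable M"
    and int: "\<And>R. R \<ge> 0 \<Longrightarrow> integrable M (\<lambda>x. f x * exp (R * \<bar>g x\<bar>))"
  shows "(\<lambda>s. \<integral>x. complex_of_real (f x) * exp (s * complex_of_real (g x)) \<partial>M) analytic_on UNIV"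
proof -
  define a where "a n = (\<integral>x. complex_of_real (f x) * complex_of_real (g x) ^ n / fact n \<partial>M)" for n
  have sums: "(\<lambda>n. a n * s ^ n) sums (\<integral>x. complex_of_real (f x) * exp (s * complex_of_real (g x)) \<partial>M)" for s
  proof -
    define h where "h n x = complex_of_real (f x) * ((s * complex_of_real (g x)) ^ n / fact n)" for n x
    define b where "b x = \<bar>f x\<bar> * exp (norm s * \<bar>g x\<bar>)" for x
    have b_int: "integrable M b"
      using integrable_norm[OF int[of "norm s"]] by (simp add: b_def[abs_def] abs_mult)
    have exp_sums: "(\<lambda>n. y ^ n / fact n) sums exp y" for y :: "'b :: {real_normed_field, banach}"
      using exp_converges[of y] by (simp add: scaleR_conv_of_real field_simps)
    have norm_h: "norm (h n x) = \<bar>f x\<bar> * ((norm s * \<bar>g x\<bar>) ^ n / fact n)" for n x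
      by (simp add: h_def norm_mult norm_divide norm_power)
    have norm_h_sums: "(\<lambda>n. norm (h n x)) sums b x" for x
      unfolding norm_h b_def by (intro sums_mult exp_sums)
    have h_int: "integrable M (h n)" for n
    proof (rule Bochner_Integration.integrable_bound[OF b_int])
      show "h n \<in> borel_measurable M" unfolding h_def[abs_def] by measurable
      have "norm (h n x) \<le> b x" for x
        using sum_le_suminf[OF sums_summable[OF norm_h_sums], of "{n}"] sums_unique[OF norm_h_sums] by simp
      thus "AE x in M. norm (h n x) \<le> norm (b x)" by (intro AE_I2) (metis abs_ge_self order_trans real_norm_def)
    qed
    have "summable (\<lambda>n. \<integral>x. norm (h n x) \<partial>M)"
    proof (rule summableI_nonneg_bounded)
      fix n
      have "(\<Sum>i<n. \<integral>x. norm (h i x) \<partial>M) = (\<integral>x. (\<Sum>i<n. norm (h i x)) \<partial>M)"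
        by (intro Bochner_Integration.integral_sum[symmetric] integrable_norm h_int)
      also have "\<dots> \<le> (\<integral>x. b x \<partial>M)"
      proof (rule integral_mono)
        show "(\<Sum>i<n. norm (h i x)) \<le> b x" for x
          using sum_le_suminf[OF sums_summable[OF norm_h_sums], of "{..<n}"] sums_unique[OF norm_h_sums] by simp
      qed (use h_int b_int in auto)
      finally show "(\<Sum>i<n. \<integral>x. norm (h i x) \<partial>M) \<le> (\<integral>x. b x \<partial>M)" .
    qed auto
    hence "(\<lambda>n. \<integral>x. h n x \<partial>M) sums (\<integral>x. (\<Sum>n. h n x) \<partial>M)"
      by (intro sums_integral h_int AE_I2 sums_summable[OF norm_h_sums])
    moreover have "(\<Sum>n. h n x) = complex_of_real (f x) * exp (s * complex_of_real (g x))" for x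
      unfolding h_def by (intro sums_unique[symmetric] sums_mult exp_sums)
    moreover have "(\<integral>x. h n x \<partial>M) = a n * s ^ n" for n
    proof -
      have "(\<integral>x. h n x \<partial>M) = (\<integral>x. s ^ n * (complex_of_real (f x) * complex_of_real (g x) ^ n / fact n) \<partial>M)"
        by (simp add: h_def power_mult_distrib mult_ac)
      thus ?thesis by (simp add: a_def mult.commute)
    qed
    ultimately show ?thesis by simp
  qed
  have "(\<lambda>s. \<integral>x. complex_of_real (f x) * exp (s * complex_of_real (g x)) \<partial>M) analytic_on {z}" for z
  proof (rule analytic_on_subset)
    show "(\<lambda>s. \<integral>x. complex_of_real (f x) * exp (s * complex_of_real (g x)) \<partial>M) analytic_on ball 0 (norm z + 1)"
      by (rule power_series_analytic) (use sums in auto)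
  qed auto
  thus ?thesis
    by (subst analytic_on_analytic_at) blast
qed

text \<open>Identity theorem: the difference is zero, or nonzero, off a sparse set, and agreement on
  the open set \<open>U\<close> rules out the second case. This makes the continuation that defines
  \<open>spectral_zeta\<close> unique.\<close>

lemma nicely_meromorphic_on_eqI:
  assumes f: "f nicely_meromorphic_on UNIV" and g: "g nicely_meromorphic_on UNIV"
    and U: "open U" "z0 \<in> U" "\<And>z. z \<in> U \<Longrightarrow> f z = g z"
  shows "f = g"
proof
  fix z
  \<comment> \<open>A nicely meromorphic function is its own normal form, with value 0 at poles, so
    agreement near a point forces agreement at the point.\<close>
  have nice: "h z = remove_sings h z" if "h nicely_meromorphic_on UNIV" for h
  proof (cases "is_pole h z")
    case True
    hence "\<not> h \<midarrow>z\<rightarrow> h z"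
      unfolding is_pole_def using not_tendsto_and_filterlim_at_infinity[OF at_neq_bot] by blast
    with that have "h z = 0" by (auto simp: nicely_meromorphic_on_def)
    thus ?thesis using True by simp
  next
    case False
    thus ?thesis using nicely_meromorphic_on_imp_analytic_at[OF that, of z] by simp
  qed
  have "(\<lambda>z. f z - g z) meromorphic_on UNIV"
    using f g by (intro meromorphic_intros) (auto simp: nicely_meromorphic_on_def)
  hence "eventually (\<lambda>z. f z - g z = 0) (cosparse UNIV) \<or> eventually (\<lambda>z. f z - g z \<noteq> 0) (cosparse UNIV)"
    by (rule meromorphic_imp_constant_or_avoid) auto
  moreover have "\<not> eventually (\<lambda>z. f z - g z \<noteq> 0) (cosparse UNIV)"
  proof
    assume "eventually (\<lambda>z. f z - g z \<noteq> 0) (cosparse UNIV)"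
    hence "eventually (\<lambda>z. f z - g z \<noteq> 0) (at z0)"
      by (simp add: eventually_cosparse_open_eq)
    moreover have "eventually (\<lambda>z. z \<in> U) (at z0)"
      using U by (intro eventually_at_in_open')
    ultimately have "eventually (\<lambda>z. False) (at z0)"
      by eventually_elim (use U(3) in auto)
    thus False by simp
  qed
  ultimately have "eventually (\<lambda>z. f z - g z = 0) (cosparse UNIV)"
    by blast
  hence "eventually (\<lambda>w. f w = g w) (at z)"
    by (simp add: eventually_cosparse_open_eq)
  hence "remove_sings f z = remove_sings g z"
    by (intro remove_sings_cong) auto
  thus "f z = g z"
    using nice[OF f] nice[OF g] by simp
qed

text \<open>Euler's integral after the substitution \<open>t -> a * t\<close>. With \<open>a\<close>
  a frequency of the lattice it expresses a term of the zeta series as a Mellin integral of an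
  exponential.\<close>

lemma Gamma_integral_scaled:
  fixes a :: real
  assumes "a > 0" "Re z > 0"
  shows "has_bochner_integral lborel
    (\<lambda>t. indicator {0<..} t *\<^sub>R (complex_of_real t powr (z - 1) * complex_of_real (exp (- a * t))))
    (Gamma z * complex_of_real a powr (- z))"
proof -
  define f where "f a t = indicator {0<..} t *\<^sub>R (complex_of_real t powr (z - 1) / complex_of_real (exp (a * t)))" for a t
  have f_int: "integrable lborel (f a)" if "a > 0" for a
  proof -
    have "integrable lebesgue (f a)"
      using absolutely_integrable_Gamma_integral[OF assms(2) that]
      by (simp add: set_integrable_def f_def[abs_def])
    moreover have "f a \<in> borel_measurable lborel"
      unfolding f_def[abs_def] by measurable
    ultimately show ?thesis by (simp add: integrable_completion)
  qed
  have "(\<integral>t. f 1 t \<partial>lborel) = Gamma z"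
    using set_borel_integral_eq_integral(2)[of "{0<..}" "\<lambda>t. complex_of_real t powr (z - 1) / complex_of_real (exp t)"]
      f_int[of 1] Gamma_integral_complex'[OF assms(2)]
    by (simp add: f_def[abs_def] set_integrable_def set_lebesgue_integral_def integral_unique)
  moreover have "f 1 (0 + a * t) = complex_of_real a powr (z - 1) * f a t" for t
    using assms by (auto simp: f_def indicator_def powr_times_real zero_less_mult_iff)
  ultimately have "Gamma z = a *\<^sub>R (complex_of_real a powr (z - 1) * (\<integral>t. f a t \<partial>lborel))"
    using lborel_integral_real_affine[of a "f 1" 0] assms by simp
  also have "\<dots> = complex_of_real a powr z * (\<integral>t. f a t \<partial>lborel)"
    using assms by (simp add: powr_diff scaleR_conv_of_real)
  finally have "(\<integral>t. f a t \<partial>lborel) = Gamma z * complex_of_real a powr (- z)"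
    using assms by (simp add: powr_minus field_simps)
  moreover have "f a = (\<lambda>t. indicator {0<..} t *\<^sub>R (complex_of_real t powr (z - 1) * complex_of_real (exp (- a * t))))"
    by (simp add: f_def fun_eq_iff divide_inverse exp_minus)
  ultimately show ?thesis
    using f_int[OF assms(1)] by (simp add: has_bochner_integral_iff)
qed

lemma powr_integral_01:
  fixes z :: complex
  assumes "Re z > 0"
  shows "has_bochner_integral lborel (\<lambda>t. indicator {0<..<1} t *\<^sub>R (complex_of_real t powr (z - 1))) (1 / z)"
proof -
  define f where "f t = complex_of_real t powr (z - 1)" for t
  have z: "z \<noteq> 0" using assms by auto
  \<comment> \<open>With second parameter 1 the Beta integrand is just
    \<open>t powr (Re z - 1)\<close> on the open interval, which serves as integrable
    majorant.\<close>
  have "set_integrable lborel {0..1} (\<lambda>t::real. t powr (Re z - 1) * (1 - t) powr (1 - 1))"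
    by (rule integrable_Beta) (use assms in auto)
  hence int: "set_integrable lborel {0<..<1} (\<lambda>t::real. t powr (Re z - 1) * (1 - t) powr (1 - 1))"
    by (rule set_integrable_subset) auto
  have f_int: "set_integrable lborel {0<..<1} f"
    unfolding set_integrable_def
  proof (rule Bochner_Integration.integrable_bound[OF int[unfolded set_integrable_def]])
    show "(\<lambda>x. indicat_real {0<..<1} x *\<^sub>R f x) \<in> borel_measurable lborel"
      unfolding f_def by measurable
  qed (auto simp: f_def indicator_def norm_powr_real_powr)
  have "(f has_integral (of_real 1 powr z / z - of_real 0 powr z / z)) {0..1}"
  proof (rule fundamental_theorem_of_calculus_interior)
    show "continuous_on {0..1} (\<lambda>t. complex_of_real t powr z / z)"
      using z assms by (intro continuous_intros) auto
    show "((\<lambda>t. complex_of_real t powr z / z) has_vector_derivative f t) (at t)" if "t \<in> {0<..<1}" for t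
    proof -
      have "((\<lambda>w. w powr z / z) has_field_derivative f t) (at (complex_of_real t))"
        using that z by (auto intro!: derivative_eq_intros simp: f_def)
      from has_vector_derivative_real_field[OF this] show ?thesis .
    qed
  qed auto
  hence "(f has_integral (1 / z)) {0..1}" by simp
  hence "(f has_integral (1 / z)) {0<..<1}"
    using has_integral_open_interval[of f "1 / z" 0 1] by simp
  thus ?thesis
    using f_int set_borel_integral_eq_integral(2)[OF f_int]
    by (simp add: has_bochner_integral_iff set_integrable_def set_lebesgue_integral_def f_def integral_unique)
qed

section \<open>The theta function of a rectangular lattice\<close>

text \<open>Antitonicity on the positive reals already yields measurability; the cut-off at 0
  removes the arguments at which the theta series diverges.\<close>

lemma borel_measurable_theta:
  "(\<lambda>x. if x > 0 then theta x else 0) \<in> borel_measurable borel"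
proof -
  have "mono_on {0<..} (\<lambda>x. - theta x)"
    by (intro mono_onI) (use theta_antimono in auto)
  hence "(\<lambda>x. - theta x) \<in> borel_measurable (restrict_space borel {0<..})"
    by (rule borel_measurable_mono_on_fnc)
  hence "theta \<in> borel_measurable (restrict_space borel {0<..})"
    by (subst (asm) borel_measurable_uminus_eq)
  hence "(\<lambda>x. indicator {0<..} x *\<^sub>R theta x) \<in> borel_measurable borel"
    by (subst (asm) borel_measurable_restrict_space_iff) auto
  also have "(\<lambda>x. indicator {0<..} x *\<^sub>R theta x) = (\<lambda>x. if x > 0 then theta x else 0)"
    by auto
  finally show ?thesis .
qed

text \<open>A Bernoulli inequality: the mixed terms of the expanded product are nonnegative. It
  makes the later lower bound linear in the number of weights.\<close>

lemma prod_ge_one_plus_sum: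
  fixes x :: "'i \<Rightarrow> real"
  assumes "\<And>i. i \<in> A \<Longrightarrow> x i \<ge> 1"
  shows "(\<Prod>i\<in>A. x i) \<ge> 1 + (\<Sum>i\<in>A. x i - 1)"
  using assms
proof (induction A rule: infinite_finite_induct)
  case (insert j A)
  have "0 \<le> (\<Sum>i\<in>A. x i - 1)"
    using insert.prems by (intro sum_nonneg) auto
  hence "0 \<le> (x j - 1) * (\<Sum>i\<in>A. x i - 1)"
    using insert.prems by (intro mult_nonneg_nonneg) auto
  hence "1 + (\<Sum>i\<in>insert j A. x i - 1) \<le> x j * (1 + (\<Sum>i\<in>A. x i - 1))"
    using insert.hyps by (simp add: algebra_simps)
  also have "\<dots> \<le> x j * (\<Prod>i\<in>A. x i)"
    using insert.IH insert.prems by (intro mult_left_mono) (auto intro: order_trans[OF zero_le_one])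
  finally show ?case using insert.hyps by simp
qed auto

text \<open>A single term of the exponential series, of integer degree
  \<open>N >= \<bar>q\<bar>\<close>, already dominates the power.\<close>

lemma powr_mult_exp_neg_bounded:
  fixes q m :: real
  assumes m: "m > 0"
  obtains C where "\<And>x. x \<ge> 1 \<Longrightarrow> x powr q * exp (- m * x) \<le> C"
proof
  fix x :: real assume x: "x \<ge> 1"
  define N where "N = nat \<lceil>\<bar>q\<bar>\<rceil>"
  have "(m * x) ^ N / fact N \<le> exp (m * x)"
  proof -
    have "(\<lambda>i. (m * x) ^ i / fact i) sums exp (m * x)"
      using exp_converges[of "m * x"] by (simp add: field_simps)
    thus ?thesis
      using sum_le_suminf[of "\<lambda>i. (m * x) ^ i / fact i" "{N}"] m x sums_summable sums_unique by fastforce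
  qed
  hence "x ^ N \<le> fact N / m ^ N * exp (m * x)"
    using m by (simp add: power_mult_distrib field_simps)
  moreover have "x powr q \<le> x ^ N"
  proof -
    have "x powr q \<le> x powr real N"
      using x unfolding N_def by (intro powr_mono) linarith+
    thus ?thesis using x by (simp add: powr_realpow)
  qed
  ultimately have "x powr q \<le> fact N / m ^ N * exp (m * x)" by simp
  hence "x powr q * exp (- m * x) \<le> fact N / m ^ N * exp (m * x) * exp (- m * x)"
    by (intro mult_right_mono) auto
  also have "\<dots> = fact N / m ^ N"
    by (simp add: mult.assoc flip: exp_add)
  finally show "x powr q * exp (- m * x) \<le> fact (nat \<lceil>\<bar>q\<bar>\<rceil>) / m ^ nat \<lceil>\<bar>q\<bar>\<rceil>"
    by (simp add: N_def)
qed

section \<open>Products of theta functions and their duality\<close>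

text \<open>The weights stand for the inverse squared side lengths of a torus of unit volume. The
  product condition is preserved by \<open>a i -> 1 / a i\<close>, so every fact about these weights
  also holds for the dual lattice.\<close>

locale unimodular_weights =
  fixes n :: nat and a :: "nat \<Rightarrow> real"
  assumes n_pos: "n > 0"
    and a_pos: "i < n \<Longrightarrow> a i > 0"
    and prod_a: "(\<Prod>i<n. a i) = 1"
begin

definition lattice_theta :: "real \<Rightarrow> real" where
  "lattice_theta t = (\<Prod>i<n. theta (a i * t))"

text \<open>The Laplace eigenvalue divided by \<open>4 * pi\<close>; this scaling makes
  \<open>lattice_theta t\<close> the sum of \<open>exp (- freq k * t)\<close> over all
  \<open>k\<close>.\<close>

definition freq :: "int Matrix.vec \<Rightarrow> real" where
  "freq k = pi * (\<Sum>i<n. a i * (of_int (k $ i))\<^sup>2)"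

text \<open>The least frequency of a nonzero vector, attained at a unit vector; it is the rate of
  exponential decay of \<open>lattice_theta - 1\<close>.\<close>

definition min_freq :: real where
  "min_freq = pi * Min (a ` {..<n})"

lemma theta_ge_1: "i < n \<Longrightarrow> t > 0 \<Longrightarrow> theta (a i * t) \<ge> 1"
  using theta_ge[of "a i * t"] a_pos[of i] exp_gt_zero[of "- pi * (a i * t)"]
    mult_pos_pos[of "a i" t] by linarith

lemma lattice_theta_ge_1: "t > 0 \<Longrightarrow> lattice_theta t \<ge> 1"
  unfolding lattice_theta_def by (intro prod_ge_1) (auto intro: theta_ge_1)

lemma min_freq_pos: "min_freq > 0"
proof -
  have "Min (a ` {..<n}) \<in> a ` {..<n}" using n_pos by (intro Min_in) auto
  thus ?thesis using a_pos by (auto simp: min_freq_def)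
qed

lemma freq_ge:
  assumes "k \<in> carrier_vec n - {0\<^sub>v n}"
  shows "freq k \<ge> min_freq"
proof -
  obtain j where j: "j < n" "k $ j \<noteq> 0"
  proof -
    have "k = 0\<^sub>v n" if "\<And>j. j < n \<Longrightarrow> k $ j = 0"
      using assms that by (intro eq_vecI) auto
    thus ?thesis using assms that by blast
  qed
  have "1 \<le> \<bar>k $ j\<bar> ^ 2" using j by (intro one_le_power) auto
  hence "real_of_int 1 \<le> real_of_int ((k $ j)\<^sup>2)"
    by (simp only: of_int_le_iff power2_abs)
  hence "a j * 1 \<le> a j * (of_int (k $ j))\<^sup>2"
    using a_pos[OF j(1)] by (intro mult_left_mono) auto
  moreover have "Min (a ` {..<n}) \<le> a j" using j by (intro Min_le) auto
  moreover have "a j * (of_int (k $ j))\<^sup>2 \<le> (\<Sum>i<n. a i * (of_int (k $ i))\<^sup>2)"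
    using j a_pos by (intro member_le_sum) (auto intro!: mult_nonneg_nonneg simp: less_imp_le)
  ultimately show ?thesis
    unfolding freq_def min_freq_def by (intro mult_left_mono) auto
qed

text \<open>Expanding the product of \<open>n\<close> series gives a sum over all functions from
  \<open>{..<n}\<close> to the integers, which \<open>Matrix.vec n\<close> identifies with integer
  vectors.\<close>

lemma lattice_theta_has_sum:
  assumes t: "t > 0"
  shows "((\<lambda>k. exp (- freq k * t)) has_sum lattice_theta t) (carrier_vec n)"
proof -
  define f where "f i k = exp (- pi * (a i * t) * (of_int k)\<^sup>2)" for i and k :: int
  have "bij_betw (Matrix.vec n) (PiE {..<n} (\<lambda>_. UNIV :: int set)) (carrier_vec n)"
    by (rule bij_betwI[where g = "\<lambda>v :: int Matrix.vec. \<lambda>i. if i < n then v $ i else undefined"])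
       (auto simp: fun_eq_iff PiE_def extensional_def)
  note bij = has_sum_reindex_bij_betw[OF this]
  have eq: "exp (- freq (Matrix.vec n g) * t) = (\<Prod>i<n. f i (g i))" for g
  proof -
    have "- freq (Matrix.vec n g) * t = - pi * t * (\<Sum>i<n. a i * (of_int (g i))\<^sup>2)"
      by (simp add: freq_def)
    also have "\<dots> = (\<Sum>i<n. - pi * (a i * t) * (of_int (g i))\<^sup>2)"
      unfolding sum_distrib_left by (intro sum.cong) auto
    finally show ?thesis
      by (simp only: f_def exp_sum finite_lessThan)
  qed
  have infsum: "(\<Sum>\<^sub>\<infinity>g\<in>PiE {..<n} (\<lambda>_. UNIV). \<Prod>i<n. f i (g i)) = lattice_theta t"
  proof (subst infsum_prod_PiE_abs)
    show "(\<lambda>k. norm (f i k)) summable_on UNIV" if "i \<in> {..<n}" for i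
      using theta_summable[of "a i * t"] a_pos[of i] that t by (simp add: f_def)
  qed (auto simp: f_def[abs_def] lattice_theta_def theta_def)
  \<comment> \<open>A family that is not summable has \<open>infsum\<close> 0, but here the value is
    at least 1.\<close>
  hence "(\<lambda>g. \<Prod>i<n. f i (g i)) summable_on PiE {..<n} (\<lambda>_. UNIV)"
    using lattice_theta_ge_1[OF t] infsum_not_exists by (metis not_one_le_zero)
  hence "((\<lambda>g. \<Prod>i<n. f i (g i)) has_sum lattice_theta t) (PiE {..<n} (\<lambda>_. UNIV))"
    using has_sum_infsum unfolding infsum[symmetric] by blast
  thus ?thesis
    by (subst bij[symmetric]) (simp only: eq)
qed

lemma lattice_theta_minus_1_has_sum:
  assumes t: "t > 0"
  shows "((\<lambda>k. exp (- freq k * t)) has_sum lattice_theta t - 1) (carrier_vec n - {0\<^sub>v n})"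
proof -
  have "((\<lambda>k. exp (- freq k * t)) has_sum 1) {0\<^sub>v n}"
    by (rule has_sum_finiteI) (auto simp: freq_def)
  from has_sum_Diff[OF lattice_theta_has_sum[OF t] this] show ?thesis by auto
qed

text \<open>Each term splits as \<open>exp (- freq k) * exp (- freq k * (t - 1))\<close>, and the
  second factor is at most \<open>exp (- min_freq * (t - 1))\<close>.\<close>

lemma lattice_theta_decay:
  assumes "t \<ge> 1"
  shows "lattice_theta t - 1 \<le> (lattice_theta 1 - 1) * exp (- min_freq * (t - 1))"
proof -
  have "lattice_theta t - 1 = (\<Sum>\<^sub>\<infinity>k\<in>carrier_vec n - {0\<^sub>v n}. exp (- freq k * t))"
    using infsumI[OF lattice_theta_minus_1_has_sum[of t]] assms by simp
  also have "\<dots> \<le> (\<Sum>\<^sub>\<infinity>k\<in>carrier_vec n - {0\<^sub>v n}. exp (- freq k * 1) * exp (- min_freq * (t - 1)))"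
  proof (rule infsum_mono)
    show "(\<lambda>k. exp (- freq k * t)) summable_on carrier_vec n - {0\<^sub>v n}"
      using lattice_theta_minus_1_has_sum[of t] assms by (auto intro: has_sum_imp_summable)
    show "(\<lambda>k. exp (- freq k * 1) * exp (- min_freq * (t - 1))) summable_on carrier_vec n - {0\<^sub>v n}"
      using lattice_theta_minus_1_has_sum[of 1]
      by (intro summable_on_cmult_left) (auto intro: has_sum_imp_summable)
    fix k :: "int Matrix.vec" assume "k \<in> carrier_vec n - {0\<^sub>v n}"
    hence "min_freq * (t - 1) \<le> freq k * (t - 1)"
      using assms by (intro mult_right_mono freq_ge) auto
    thus "exp (- freq k * t) \<le> exp (- freq k * 1) * exp (- min_freq * (t - 1))"
      by (simp add: algebra_simps flip: exp_add)
  qed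
  also have "\<dots> = (lattice_theta 1 - 1) * exp (- min_freq * (t - 1))"
    using infsumI[OF lattice_theta_minus_1_has_sum[of 1]] by (simp only: infsum_cmult_left' zero_less_one)
  finally show ?thesis .
qed

lemma dual: "unimodular_weights n (\<lambda>i. 1 / a i)"
  by unfold_locales (use n_pos a_pos prod_a in \<open>auto simp: prod_dividef\<close>)

text \<open>Jacobi's identity is applied in each factor. The constants \<open>sqrt (1 / a i)\<close>
  multiply to 1 because the weights have product 1.\<close>

lemma lattice_theta_dual:
  assumes t: "t > 0"
  shows "lattice_theta t = t powr (- real n / 2) * unimodular_weights.lattice_theta n (\<lambda>i. 1 / a i) (1 / t)"
proof -
  have sqrt_prod: "(\<Prod>i<m. sqrt (1 / a i)) = sqrt (1 / (\<Prod>i<m. a i))" for m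
    by (induction m) (auto simp: real_sqrt_mult real_sqrt_divide)
  have "theta (a i * t) = t powr (- 1 / 2) * (sqrt (1 / a i) * theta (1 / a i * (1 / t)))" if "i < n" for i
  proof -
    have "theta (1 / (1 / a i * (1 / t))) = sqrt (1 / a i * (1 / t)) * theta (1 / a i * (1 / t))"
      by (rule theta_inverse) (use a_pos[OF that] t in auto)
    moreover have "1 / (1 / a i * (1 / t)) = a i * t" by simp
    moreover have "sqrt (1 / a i * (1 / t)) = t powr (- 1 / 2) * sqrt (1 / a i)"
    proof -
      have "t powr (- 1 / 2) = sqrt (1 / t)"
        using t by (simp add: powr_minus_divide powr_half_sqrt real_sqrt_divide)
      thus ?thesis by (simp only: real_sqrt_mult mult.commute)
    qed
    ultimately show ?thesis by (simp only: mult.assoc)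
  qed
  hence "lattice_theta t = (\<Prod>i<n. t powr (- 1 / 2) * (sqrt (1 / a i) * theta (1 / a i * (1 / t))))"
    unfolding lattice_theta_def by (intro prod.cong) auto
  also have "\<dots> = (t powr (- 1 / 2)) ^ n * ((\<Prod>i<n. sqrt (1 / a i)) * (\<Prod>i<n. theta (1 / a i * (1 / t))))"
    by (simp add: prod.distrib)
  also have "(\<Prod>i<n. sqrt (1 / a i)) = 1"
    unfolding sqrt_prod by (simp add: prod_a)
  also have "(t powr (- 1 / 2)) ^ n = t powr (- real n / 2)"
    using t powr_realpow[of "t powr (- 1 / 2)" n] by (simp add: powr_powr)
  finally show ?thesis
    by (simp add: unimodular_weights.lattice_theta_def[OF dual])
qed

abbreviation dual_theta :: "real \<Rightarrow> real" where
  "dual_theta \<equiv> unimodular_weights.lattice_theta n (\<lambda>i. 1 / a i)"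

text \<open>The integrand, up to \<open>t powr s\<close>, of the Mellin transform of \<open>lattice_theta - 1\<close> after its
  nonintegrable parts \<open>t powr (- n / 2)\<close> and \<open>1\<close> on \<open>(0, 1)\<close> are split off.\<close>

definition remainder :: "real \<Rightarrow> real" where
  "remainder t =
     (if t \<le> 0 then 0
      else if t < 1 then (lattice_theta t - t powr (- real n / 2)) / t
      else (lattice_theta t - 1) / t)"

text \<open>Duality turns the difference near 0 into a tail of the dual theta function, which is
  visibly nonnegative and decays exponentially in \<open>1 / t\<close>.\<close>

lemma remainder_less_1:
  assumes "0 < t" "t < 1"
  shows "remainder t = t powr (- real n / 2 - 1) * (dual_theta (1 / t) - 1)"
proof -
  have p: "t powr (- real n / 2 - 1) = t powr (- real n / 2) / t"
    using assms powr_diff[of t "- real n / 2" 1] by (simp only: powr_one less_imp_le)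
  show ?thesis
    unfolding p using assms by (simp add: remainder_def lattice_theta_dual field_simps)
qed

lemma remainder_nonneg: "remainder t \<ge> 0"
proof (cases "0 < t \<and> t < 1")
  case True
  thus ?thesis
    using unimodular_weights.lattice_theta_ge_1[OF dual, of "1 / t"] by (simp add: remainder_less_1)
next
  case False
  thus ?thesis using lattice_theta_ge_1[of t] by (auto simp: remainder_def)
qed

lemma remainder_measurable [measurable]: "remainder \<in> borel_measurable borel"
proof -
  define T where "T x = (if x > 0 then theta x else 0)" for x
  have [measurable]: "T \<in> borel_measurable borel"
    unfolding T_def using borel_measurable_theta .
  have "remainder = (\<lambda>t. if t \<le> 0 then 0
      else if t < 1 then ((\<Prod>i<n. T (a i * t)) - t powr (- real n / 2)) / t
      else ((\<Prod>i<n. T (a i * t)) - 1) / t)"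
  proof
    fix t
    have "T (a i * t) = theta (a i * t)" if "t > 0" "i < n" for i
      using that a_pos[of i] by (simp add: T_def)
    thus "remainder t = (if t \<le> 0 then 0
      else if t < 1 then ((\<Prod>i<n. T (a i * t)) - t powr (- real n / 2)) / t
      else ((\<Prod>i<n. T (a i * t)) - 1) / t)"
      by (auto simp: remainder_def lattice_theta_def)
  qed
  thus ?thesis by (simp only:) measurable
qed

text \<open>The factor \<open>exp (R * \<bar>ln t\<bar>)\<close> dominates \<open>t powr s\<close>
  for all \<open>\<bar>Re s\<bar> <= R\<close>. On \<open>(0, 1)\<close> the dual decay beats every
  power of \<open>1 / t\<close> and leaves a constant bound; on \<open>[1, \<infinity>)\<close> the
  integrand is compared with that of a Gamma integral.\<close>

lemma remainder_exp_integrable: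
  assumes R: "R \<ge> 0"
  shows "integrable lborel (\<lambda>t. remainder t * exp (R * \<bar>ln t\<bar>))"
proof -
  define m' where "m' = unimodular_weights.min_freq n (\<lambda>i. 1 / a i)"
  define K where "K = (lattice_theta 1 - 1) * exp min_freq"
  define K' where "K' = (dual_theta 1 - 1) * exp m'"
  have m': "m' > 0" unfolding m'_def by (rule unimodular_weights.min_freq_pos[OF dual])
  have K: "K \<ge> 0" "K' \<ge> 0"
    using lattice_theta_ge_1[of 1] unimodular_weights.lattice_theta_ge_1[OF dual, of 1]
    by (auto simp: K_def K'_def)
  obtain C where C: "\<And>x. x \<ge> 1 \<Longrightarrow> x powr (real n / 2 + 1 + R) * exp (- m' * x) \<le> C"
    using powr_mult_exp_neg_bounded[OF m'] by blast
  define g where "g t = indicator {0<..} t *\<^sub>R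
      (complex_of_real t powr (complex_of_real (R + 1) - 1) * complex_of_real (exp (- min_freq * t)))" for t
  define b where "b t = K' * C * indicator {0<..<1} t + K * norm (g t)" for t :: real
  have "integrable lborel g"
    using Gamma_integral_scaled[OF min_freq_pos, of "complex_of_real (R + 1)"] R
    by (simp add: has_bochner_integral_iff g_def[abs_def])
  hence b_int: "integrable lborel b"
    unfolding b_def by (intro Bochner_Integration.integrable_add integrable_mult_right) auto
  have norm_g: "norm (g t) = t powr R * exp (- min_freq * t)" if "t > 0" for t
    using that by (simp add: g_def norm_mult norm_powr_real_powr)
  show ?thesis
  proof (rule Bochner_Integration.integrable_bound[OF b_int])
    show "(\<lambda>t. remainder t * exp (R * \<bar>ln t\<bar>)) \<in> borel_measurable lborel" by measurable
    have "remainder t * exp (R * \<bar>ln t\<bar>) \<le> b t" for t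
    proof -
      consider "t \<le> 0" | "0 < t" "t < 1" | "t \<ge> 1" by linarith
      thus ?thesis
      proof cases
        case 1
        thus ?thesis using K by (simp add: b_def remainder_def)
      next
        case 2
        hence "dual_theta (1 / t) - 1 \<le> (dual_theta 1 - 1) * exp (- m' * (1 / t - 1))"
          unfolding m'_def by (intro unimodular_weights.lattice_theta_decay[OF dual]) auto
        also have "\<dots> = K' * exp (- m' * (1 / t))"
          by (simp add: K'_def algebra_simps flip: exp_add)
        finally have "remainder t \<le> t powr (- real n / 2 - 1) * (K' * exp (- m' * (1 / t)))"
          using 2 by (simp add: remainder_less_1 mult_left_mono)
        moreover have "exp (R * \<bar>ln t\<bar>) = t powr (- R)"
          using 2 by (simp add: powr_def abs_if)
        ultimately have "remainder t * exp (R * \<bar>ln t\<bar>)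
            \<le> t powr (- real n / 2 - 1) * (K' * exp (- m' * (1 / t))) * t powr (- R)"
          by (simp add: mult_right_mono)
        also have "\<dots> = K' * ((1 / t) powr (real n / 2 + 1 + R) * exp (- m' * (1 / t)))"
        proof -
          have "t powr (- real n / 2 - 1) * t powr (- R) = t powr (- (real n / 2 + 1 + R))"
          proof -
            have "- real n / 2 - 1 + - R = - (real n / 2 + 1 + R)" by simp
            thus ?thesis by (metis powr_add)
          qed
          also have "\<dots> = (1 / t) powr (real n / 2 + 1 + R)"
            using 2 by (simp only: powr_minus_divide powr_divide powr_one_eq_one)
          finally have p: "t powr (- real n / 2 - 1) * t powr (- R) = (1 / t) powr (real n / 2 + 1 + R)" .
          have "t powr (- real n / 2 - 1) * (K' * exp (- m' * (1 / t))) * t powr (- R)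
              = K' * ((t powr (- real n / 2 - 1) * t powr (- R)) * exp (- m' * (1 / t)))"
            by (simp only: mult_ac)
          thus ?thesis unfolding p .
        qed
        also have "\<dots> \<le> K' * C"
          using 2 K by (intro mult_left_mono C) auto
        also have "\<dots> \<le> b t"
          using 2 K by (simp add: b_def)
        finally show ?thesis .
      next
        case 3
        have "remainder t \<le> lattice_theta t - 1"
          using 3 lattice_theta_ge_1[of t] divide_left_mono[of 1 t "lattice_theta t - 1"]
          by (simp add: remainder_def)
        also have "\<dots> \<le> (lattice_theta 1 - 1) * exp (- min_freq * (t - 1))"
          by (rule lattice_theta_decay[OF 3])
        also have "\<dots> = K * exp (- min_freq * t)"
          by (simp add: K_def algebra_simps flip: exp_add)
        finally have "remainder t * exp (R * \<bar>ln t\<bar>) \<le> K * exp (- min_freq * t) * exp (R * \<bar>ln t\<bar>)"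
          by (intro mult_right_mono) auto
        also have "\<dots> = b t"
        proof -
          have "exp (R * \<bar>ln t\<bar>) = t powr R"
            using 3 by (simp add: powr_def abs_if)
          thus ?thesis using 3 by (simp add: b_def norm_g)
        qed
        finally show ?thesis .
      qed
    qed
    hence "norm (remainder t * exp (R * \<bar>ln t\<bar>)) \<le> norm (b t)" for t
      unfolding real_norm_def abs_mult abs_exp_cancel abs_of_nonneg[OF remainder_nonneg]
      by (rule order_trans[OF _ abs_ge_self])
    thus "AE t in lborel. norm (remainder t * exp (R * \<bar>ln t\<bar>)) \<le> norm (b t)"
      by (intro AE_I2)
  qed
qed

lemma remainder_integrable: "integrable lborel remainder"
  using remainder_exp_integrable[of 0] by simp

section \<open>Mellin transform and continuation of the spectral zeta function\<close>

text \<open>The Mellin transform of the tamed theta function: the division by \<open>t\<close> in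
  \<open>remainder\<close> accounts for the measure \<open>dt / t\<close>, and
  \<open>exp (s * ln t)\<close> is \<open>t powr s\<close> in the form that
  \<open>analytic_integral_exp\<close> treats.\<close>

definition entire_part :: "complex \<Rightarrow> complex" where
  "entire_part s = (\<integral>t. complex_of_real (remainder t) * exp (s * complex_of_real (ln t)) \<partial>lborel)"

lemma entire_part_analytic: "entire_part analytic_on UNIV"
  unfolding entire_part_def[abs_def]
  by (rule analytic_integral_exp[OF _ _ remainder_exp_integrable]) auto

lemma entire_part_0: "entire_part 0 = complex_of_real (\<integral>t. remainder t \<partial>lborel)"
  by (simp add: entire_part_def)

text \<open>The parts split off on \<open>(0, 1)\<close> are put back:
  \<open>t powr (s - n / 2 - 1)\<close> integrates to \<open>1 / (s - n / 2)\<close> and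
  \<open>t powr (s - 1)\<close> to \<open>1 / s\<close>. Both converge as
  \<open>Re s > n / 2\<close>.\<close>

lemma lattice_theta_mellin:
  assumes s: "Re s > real n / 2"
  shows "has_bochner_integral lborel
    (\<lambda>t. indicator {0<..} t *\<^sub>R (complex_of_real t powr (s - 1) * complex_of_real (lattice_theta t - 1)))
    (entire_part s + 1 / (s - of_nat n / 2) - 1 / s)"
proof -
  have "integrable lborel (\<lambda>t. complex_of_real (remainder t) * exp (s * complex_of_real (ln t)))"
  proof (rule Bochner_Integration.integrable_bound[OF remainder_exp_integrable[of "\<bar>Re s\<bar>"]])
    show "AE t in lborel. norm (complex_of_real (remainder t) * exp (s * complex_of_real (ln t)))
        \<le> norm (remainder t * exp (\<bar>Re s\<bar> * \<bar>ln t\<bar>))"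
    proof (intro AE_I2)
      fix t :: real
      have "Re s * ln t \<le> \<bar>Re s\<bar> * \<bar>ln t\<bar>" by (metis abs_ge_self abs_mult)
      thus "norm (complex_of_real (remainder t) * exp (s * complex_of_real (ln t)))
        \<le> norm (remainder t * exp (\<bar>Re s\<bar> * \<bar>ln t\<bar>))"
        by (simp add: norm_mult abs_mult mult_left_mono)
    qed
  qed auto
  hence 1: "has_bochner_integral lborel
      (\<lambda>t. complex_of_real (remainder t) * exp (s * complex_of_real (ln t))) (entire_part s)"
    by (simp add: has_bochner_integral_iff entire_part_def)
  have 2: "has_bochner_integral lborel
      (\<lambda>t. indicator {0<..<1} t *\<^sub>R (complex_of_real t powr (s - of_nat n / 2 - 1))) (1 / (s - of_nat n / 2))"
    by (rule powr_integral_01) (use s in auto)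
  have 3: "has_bochner_integral lborel
      (\<lambda>t. indicator {0<..<1} t *\<^sub>R (complex_of_real t powr (s - 1))) (1 / s)"
    by (rule powr_integral_01) (use s in \<open>auto intro: le_less_trans[of _ "real n / 2"]\<close>)
  have eq: "complex_of_real (remainder t) * exp (s * complex_of_real (ln t))
      + indicator {0<..<1} t *\<^sub>R (complex_of_real t powr (s - of_nat n / 2 - 1))
      - indicator {0<..<1} t *\<^sub>R (complex_of_real t powr (s - 1))
    = indicator {0<..} t *\<^sub>R (complex_of_real t powr (s - 1) * complex_of_real (lattice_theta t - 1))" for t
  proof (cases "t > 0")
    case False
    thus ?thesis by (simp add: remainder_def)
  next
    case t: True
    have e: "exp (s * complex_of_real (ln t)) = complex_of_real t * complex_of_real t powr (s - 1)"
      using t by (simp add: powr_diff) (simp add: powr_def Ln_of_real)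
    have p: "complex_of_real t powr (s - of_nat n / 2 - 1)
        = complex_of_real t powr (s - 1) * complex_of_real (t powr (- real n / 2))"
    proof -
      have "s - of_nat n / 2 - 1 = (s - 1) + complex_of_real (- real n / 2)" by simp
      thus ?thesis using t by (simp only: powr_add powr_of_real less_imp_le)
    qed
    show ?thesis
    proof (cases "t < 1")
      case True
      thus ?thesis using t unfolding e p by (simp add: remainder_def field_simps)
    next
      case False
      thus ?thesis using t unfolding e by (simp add: remainder_def)
    qed
  qed
  show ?thesis
    using has_bochner_integral_diff[OF has_bochner_integral_add[OF 1 2] 3] unfolding eq .
qed

lemma countable_carrier_vec: "countable (carrier_vec n :: int Matrix.vec set)"
proof -
  have "carrier_vec n \<subseteq> range (vec_of_list :: int list \<Rightarrow> _)"
    by (metis vec_list rangeI subsetI)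
  thus ?thesis by (rule countable_subset) auto
qed

text \<open>Each term is a Gamma integral; summing under the integral sign produces the Mellin
  transform of \<open>lattice_theta - 1\<close>, and \<open>rGamma s\<close> divides out
  \<open>Gamma s\<close>.\<close>

lemma freq_powr_has_sum:
  assumes s: "Re s > real n / 2"
  shows "((\<lambda>k. complex_of_real (freq k) powr (- s)) has_sum
     rGamma s * (entire_part s + 1 / (s - of_nat n / 2) - 1 / s)) (carrier_vec n - {0\<^sub>v n})"
proof -
  define I :: "int Matrix.vec set" where "I = carrier_vec n - {0\<^sub>v n}"
  define f where "f k t = indicator {0<..} t *\<^sub>R
     (complex_of_real t powr (s - 1) * complex_of_real (exp (- freq k * t)))" for k t
  define S where "S t = indicator {0<..} t *\<^sub>R
     (complex_of_real t powr (s - 1) * complex_of_real (lattice_theta t - 1))" for t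
  have s0: "Re s > 0" using s by (auto intro: le_less_trans[of _ "real n / 2"])
  hence Gamma: "Gamma s \<noteq> 0"
    by (auto simp: Gamma_eq_zero_iff elim!: nonpos_Ints_cases)
  have f: "has_bochner_integral lborel (f k) (Gamma s * complex_of_real (freq k) powr (- s))" if "k \<in> I" for k
    unfolding f_def
    by (rule Gamma_integral_scaled) (use that freq_ge[of k] min_freq_pos s0 in \<open>auto simp: I_def\<close>)
  have S: "has_bochner_integral lborel S (entire_part s + 1 / (s - of_nat n / 2) - 1 / s)"
    unfolding S_def by (rule lattice_theta_mellin[OF s])
  have f_has_sum: "((\<lambda>k. f k t) has_sum S t) I" for t
  proof (cases "t > 0")
    case True
    have "((\<lambda>k. complex_of_real (exp (- freq k * t))) has_sum complex_of_real (lattice_theta t - 1)) I"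
      unfolding I_def by (rule has_sum_of_real[OF lattice_theta_minus_1_has_sum[OF True]])
    from has_sum_cmult_right[OF this, of "complex_of_real t powr (s - 1)"] True show ?thesis
      by (simp add: f_def S_def)
  qed (simp add: f_def S_def)
  \<comment> \<open>For fixed \<open>t\<close> the terms are positive multiples of one complex
    number, so the norms sum to the norm of \<open>S t\<close>. Integrability of \<open>S\<close>
    therefore justifies the exchange.\<close>
  have norm_f_has_sum: "((\<lambda>k. norm (f k t)) has_sum norm (S t)) I" for t
  proof (cases "t > 0")
    case True
    have "((\<lambda>k. exp (- freq k * t)) has_sum (lattice_theta t - 1)) I"
      unfolding I_def by (rule lattice_theta_minus_1_has_sum[OF True])
    from has_sum_cmult_right[OF this, of "norm (complex_of_real t powr (s - 1))"]
    have "((\<lambda>k. norm (complex_of_real t powr (s - 1)) * exp (- freq k * t)) has_sum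
        norm (complex_of_real t powr (s - 1)) * (lattice_theta t - 1)) I" .
    moreover have "norm (complex_of_real (lattice_theta t - 1)) = lattice_theta t - 1"
      using lattice_theta_ge_1[OF True] by (simp only: norm_of_real)
    hence "norm (S t) = norm (complex_of_real t powr (s - 1)) * (lattice_theta t - 1)"
      using True by (simp only: S_def norm_scaleR norm_mult) simp
    moreover have "norm (f k t) = norm (complex_of_real t powr (s - 1)) * exp (- freq k * t)" for k
      using True by (simp add: f_def norm_mult)
    ultimately show ?thesis by (simp only:)
  qed (simp add: f_def S_def)
  have f_int: "integrable lborel (f k)" if "k \<in> I" for k
    using f[OF that] by (simp add: has_bochner_integral_iff)
  have S_int: "integrable lborel S"
    using S by (simp add: has_bochner_integral_iff)
  have "((\<lambda>k. \<integral>t. f k t \<partial>lborel) has_sum (\<integral>t. (\<Sum>\<^sub>\<infinity>k\<in>I. f k t) \<partial>lborel)) I"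
  proof (rule has_sum_integral)
    show "countable I"
      unfolding I_def using countable_carrier_vec by blast
    show "(\<lambda>k. norm (f k t)) summable_on I" for t
      using norm_f_has_sum by (rule has_sum_imp_summable)
    show "(\<lambda>k. \<integral>t. norm (f k t) \<partial>lborel) summable_on I"
    proof (rule nonneg_bdd_above_summable_on)
      show "bdd_above (sum (\<lambda>k. \<integral>t. norm (f k t) \<partial>lborel) ` {F. F \<subseteq> I \<and> finite F})"
      proof (rule bdd_aboveI2, clarify)
        fix F assume F: "F \<subseteq> I" "finite F"
        have "(\<Sum>k\<in>F. \<integral>t. norm (f k t) \<partial>lborel) = (\<integral>t. (\<Sum>k\<in>F. norm (f k t)) \<partial>lborel)"
          using f_int F by (intro Bochner_Integration.integral_sum[symmetric]) auto
        also have "\<dots> \<le> (\<integral>t. norm (S t) \<partial>lborel)"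
        proof (rule integral_mono)
          show "(\<Sum>k\<in>F. norm (f k t)) \<le> norm (S t)" for t
            by (rule finite_sum_le_has_sum[OF norm_f_has_sum]) (use F in auto)
        qed (use f_int F S_int in \<open>auto intro!: Bochner_Integration.integrable_sum\<close>)
        finally show "(\<Sum>k\<in>F. \<integral>t. norm (f k t) \<partial>lborel) \<le> (\<integral>t. norm (S t) \<partial>lborel)" .
      qed
    qed auto
  qed (use f_int in auto)
  also have "(\<lambda>t. \<Sum>\<^sub>\<infinity>k\<in>I. f k t) = S"
    using f_has_sum by (auto intro: infsumI)
  also have "integral\<^sup>L lborel S = entire_part s + 1 / (s - of_nat n / 2) - 1 / s"
    using S by (simp add: has_bochner_integral_iff)
  finally have "((\<lambda>k. \<integral>t. f k t \<partial>lborel) has_sum (entire_part s + 1 / (s - of_nat n / 2) - 1 / s)) I" .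
  from has_sum_cmult_right[OF this, of "rGamma s"]
  have "((\<lambda>k. rGamma s * (\<integral>t. f k t \<partial>lborel)) has_sum rGamma s * (entire_part s + 1 / (s - of_nat n / 2) - 1 / s)) I" .
  also have "?this \<longleftrightarrow> ((\<lambda>k. complex_of_real (freq k) powr (- s)) has_sum
      rGamma s * (entire_part s + 1 / (s - of_nat n / 2) - 1 / s)) I"
  proof (rule has_sum_cong)
    show "rGamma s * (\<integral>t. f k t \<partial>lborel) = complex_of_real (freq k) powr (- s)" if "k \<in> I" for k
      using f[OF that] Gamma by (simp add: has_bochner_integral_iff rGamma_inverse_Gamma)
  qed
  finally show ?thesis unfolding I_def .
qed

text \<open>The term \<open>- rGamma (s + 1)\<close> is \<open>rGamma s * (- 1 / s)\<close> with the singularity at 0 removed.\<close>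

definition continuation :: "complex \<Rightarrow> complex" where
  "continuation s = complex_of_real (4 * pi) powr (- s) *
     (rGamma s * entire_part s - rGamma (s + 1) + rGamma s / (s - of_nat n / 2))"

lemma continuation_meromorphic: "continuation meromorphic_on UNIV"
proof -
  have "entire_part meromorphic_on UNIV"
    by (rule analytic_on_imp_meromorphic_on[OF entire_part_analytic])
  moreover have "(\<lambda>s. complex_of_real (4 * pi) powr (- s)) meromorphic_on UNIV"
    by (intro analytic_on_imp_meromorphic_on analytic_intros) (auto simp: complex_nonpos_Reals_iff not_le)
  moreover have "(\<lambda>s :: complex. rGamma s) meromorphic_on UNIV" "(\<lambda>s :: complex. rGamma (s + 1)) meromorphic_on UNIV"
    by (intro analytic_on_imp_meromorphic_on analytic_intros)+
  ultimately show ?thesis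
    unfolding continuation_def[abs_def] by (intro meromorphic_intros)
qed

lemma continuation_analytic:
  assumes "z \<noteq> of_nat n / 2"
  shows "continuation analytic_on {z}"
proof -
  have "entire_part analytic_on {z}"
    by (rule analytic_on_subset[OF entire_part_analytic]) auto
  thus ?thesis
    unfolding continuation_def[abs_def] using assms by (intro analytic_intros) (auto simp: complex_nonpos_Reals_iff not_le)
qed

lemma spectral_zeta_series_eq:
  assumes D: "dim_row D = n" "\<And>i. i < n \<Longrightarrow> a i = 1 / (D $$ (i, i))\<^sup>2"
    and s: "Re s > real n / 2"
  shows "spectral_zeta_series D s = continuation s"
proof -
  have s0: "s \<noteq> 0" using s by auto
  have ev: "laplace_eigenvalue D k = 4 * pi * freq k" for k
    using D by (simp add: laplace_eigenvalue_def freq_def power2_eq_square)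
  have "complex_of_real (laplace_eigenvalue D k) powr (- s)
      = complex_of_real (4 * pi) powr (- s) * complex_of_real (freq k) powr (- s)"
    if "k \<in> carrier_vec n - {0\<^sub>v n}" for k
    unfolding ev of_real_mult[of "4 * pi"]
    by (rule powr_times_real) (use freq_ge[OF that] min_freq_pos in auto)
  hence "spectral_zeta_series D s = (\<Sum>\<^sub>\<infinity>k\<in>carrier_vec n - {0\<^sub>v n}.
      complex_of_real (4 * pi) powr (- s) * complex_of_real (freq k) powr (- s))"
    unfolding spectral_zeta_series_def D(1) by (rule infsum_cong)
  also have "\<dots> = complex_of_real (4 * pi) powr (- s) *
      (rGamma s * (entire_part s + 1 / (s - of_nat n / 2) - 1 / s))"
    by (rule infsumI[OF has_sum_cmult_right[OF freq_powr_has_sum[OF s]]])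
  also have "rGamma s * (entire_part s + 1 / (s - of_nat n / 2) - 1 / s)
      = rGamma s * entire_part s - rGamma s / s + rGamma s / (s - of_nat n / 2)"
    by (simp add: algebra_simps)
  also have "rGamma s / s = rGamma (s + 1)"
    using s0 rGamma_plus1[of s] by (simp add: field_simps)
  finally show ?thesis by (simp only: continuation_def)
qed

text \<open>At \<open>n / 2\<close>, where \<open>continuation\<close> divides by zero,
  \<open>remove_sings\<close> enforces the normalization demanded by
  \<open>nicely_meromorphic_on\<close>; uniqueness is the identity theorem on the half-plane of
  convergence.\<close>

lemma spectral_zeta_eq:
  assumes D: "dim_row D = n" "\<And>i. i < n \<Longrightarrow> a i = 1 / (D $$ (i, i))\<^sup>2"
  shows "spectral_zeta D = remove_sings continuation"
  unfolding spectral_zeta_def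
proof (rule the_equality)
  have eq: "remove_sings continuation s = spectral_zeta_series D s" if "Re s > real n / 2" for s
  proof -
    have "Re s \<noteq> Re (of_nat n / 2)" using that by simp
    hence "s \<noteq> of_nat n / 2" by blast
    thus ?thesis
      using spectral_zeta_series_eq[OF D that] by (simp add: continuation_analytic)
  qed
  have nice: "remove_sings continuation nicely_meromorphic_on UNIV"
    by (rule remove_sings_nicely_meromorphic[OF continuation_meromorphic])
  show "remove_sings continuation nicely_meromorphic_on UNIV \<and>
      (\<forall>s. Re s > real (dim_row D) / 2 \<longrightarrow> remove_sings continuation s = spectral_zeta_series D s)"
    using eq nice D(1) by auto
  show "Z = remove_sings continuation"
    if Z: "Z nicely_meromorphic_on UNIV \<and>
      (\<forall>s. Re s > real (dim_row D) / 2 \<longrightarrow> Z s = spectral_zeta_series D s)" for Z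
  proof (rule nicely_meromorphic_on_eqI[OF _ nice])
    show "open {s. Re s > real n / 2}" by (rule open_halfspace_Re_gt)
    show "of_nat n \<in> {s. Re s > real n / 2}" using n_pos by simp
  qed (use Z eq D(1) in auto)
qed

section \<open>The determinant formula and a uniform upper bound\<close>

text \<open>At 0 \<open>rGamma\<close> vanishes with derivative 1, so only the value of
  \<open>entire_part\<close> there survives, and the last summand gives \<open>- 2 / n\<close>. The
  derivative of \<open>rGamma\<close> at 1 is Euler's constant, and the power of
  \<open>4 * pi\<close> yields the logarithm because the bracket equals -1 at 0.\<close>

lemma zeta_det_eq:
  assumes D: "dim_row D = n" "\<And>i. i < n \<Longrightarrow> a i = 1 / (D $$ (i, i))\<^sup>2"
  shows "zeta_det D = exp (2 / real n + euler_mascheroni - ln (4 * pi) - (\<integral>t. remainder t \<partial>lborel))"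
proof -
  define J where "J = (\<integral>t. remainder t \<partial>lborel)"
  define L where "L = complex_of_real (ln (4 * pi))"
  have pw: "complex_of_real (4 * pi) powr (- s) = exp (- s * L)" for s
    using Ln_of_real[of "4 * pi"] by (simp add: powr_def L_def)
  have d_entire: "(entire_part has_field_derivative deriv entire_part 0) (at 0)"
    using analytic_on_subset[OF entire_part_analytic, of "{0}"]
    by (simp add: analytic_on_imp_differentiable_at DERIV_deriv_iff_field_differentiable)
  have d_rGamma0: "(rGamma has_field_derivative 1) (at (0 :: complex))"
    using has_field_derivative_rGamma_nonpos_int[of 0, where ?'a = complex] by simp
  have "(rGamma has_field_derivative euler_mascheroni) (at (0 + 1 :: complex))"
    using has_field_derivative_rGamma_no_nonpos_int[of "1 :: complex"] by simp
  hence d_rGamma1: "((\<lambda>s. rGamma (s + 1)) has_field_derivative euler_mascheroni) (at (0 :: complex))"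
    by (simp only: DERIV_shift)
  have "((\<lambda>s. exp (- s * L) *
     (rGamma s * entire_part s - rGamma (s + 1) + rGamma s / (s - of_nat n / 2)))
     has_field_derivative (L + complex_of_real J - euler_mascheroni - 2 / of_nat n)) (at 0)"
  proof (rule DERIV_cong)
    have "((\<lambda>s. exp (- s * L)) has_field_derivative - L) (at 0)"
      by (auto intro!: derivative_eq_intros)
    moreover have "((\<lambda>s. s - complex_of_nat n / 2) has_field_derivative 1) (at 0)"
      by (auto intro!: derivative_eq_intros)
    ultimately show "((\<lambda>s. exp (- s * L) *
       (rGamma s * entire_part s - rGamma (s + 1) + rGamma s / (s - of_nat n / 2)))
       has_field_derivative
       (- L) * (rGamma 0 * entire_part 0 - rGamma (0 + 1) + rGamma 0 / (0 - of_nat n / 2)) +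
       (1 * entire_part 0 + deriv entire_part 0 * rGamma 0 - euler_mascheroni +
        (1 * (0 - of_nat n / 2) - rGamma 0 * 1) / ((0 - of_nat n / 2) * (0 - of_nat n / 2))) * exp (- 0 * L)) (at 0)"
      using n_pos by (intro DERIV_mult DERIV_add DERIV_diff DERIV_divide d_rGamma0 d_rGamma1 d_entire) auto
  qed (use n_pos in \<open>simp add: entire_part_0 J_def field_simps\<close>)
  hence "deriv continuation 0 = L + complex_of_real J - euler_mascheroni - 2 / of_nat n"
    unfolding continuation_def[abs_def] pw by (rule DERIV_imp_deriv)
  hence "deriv (spectral_zeta D) 0 = L + complex_of_real J - euler_mascheroni - 2 / of_nat n"
    using n_pos by (simp add: spectral_zeta_eq[OF D] continuation_analytic)
  hence "- deriv (spectral_zeta D) 0 = complex_of_real (2 / real n + euler_mascheroni - ln (4 * pi) - J)"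
    by (simp add: L_def)
  thus ?thesis
    unfolding zeta_det_def J_def by (simp only: Re_complex_of_real exp_of_real)
qed

text \<open>By the Bernoulli inequality the product exceeds 1 by at least the sum of the excesses of
  its factors; each index in \<open>A\<close> contributes the terms of its theta series at 1 and
  -1.\<close>

lemma sum_theta_le_lattice_theta:
  assumes t: "t > 0" and A: "A \<subseteq> {..<n}" and le: "\<And>i. i \<in> A \<Longrightarrow> a i * t \<le> x"
  shows "lattice_theta t - 1 \<ge> real (card A) * (2 * exp (- pi * x))"
proof -
  have "real (card A) * (2 * exp (- pi * x)) = (\<Sum>i\<in>A. 2 * exp (- pi * x))" by simp
  also have "\<dots> \<le> (\<Sum>i\<in>A. theta (a i * t) - 1)"
  proof (rule sum_mono)
    fix i assume i: "i \<in> A"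
    have "2 * exp (- pi * x) \<le> 2 * exp (- pi * (a i * t))" using le[OF i] by simp
    also have "\<dots> \<le> theta (a i * t) - 1"
      using theta_ge[of "a i * t"] a_pos[of i] i A t by auto
    finally show "2 * exp (- pi * x) \<le> theta (a i * t) - 1" .
  qed
  also have "\<dots> \<le> (\<Sum>i<n. theta (a i * t) - 1)"
    using A theta_ge_1 t by (intro sum_mono2) auto
  also have "\<dots> \<le> lattice_theta t - 1"
    using prod_ge_one_plus_sum[of "{..<n}" "\<lambda>i. theta (a i * t)"] theta_ge_1 t
    by (simp add: lattice_theta_def)
  finally show ?thesis .
qed

text \<open>Every weight contributes: those with \<open>a i \<le> 1\<close> to the part of the integral over
  \<open>[1, 2]\<close>, the others, through the dual lattice, to the part over \<open>[1/2, 1)\<close>.\<close>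

lemma remainder_integral_ge: "(\<integral>t. remainder t \<partial>lborel) \<ge> real n * exp (- 2 * pi)"
proof -
  define A where "A = {i. i < n \<and> a i \<le> 1}"
  define B where "B = {i. i < n \<and> a i > 1}"
  \<comment> \<open>Each weight adds \<open>2 * exp (- 2 * pi)\<close> to the relevant theta product
    minus 1. In \<open>p\<close> the factor 2 is spent on dividing by \<open>t <= 2\<close>; in
    \<open>q\<close> it compensates for the length 1/2 of the interval.\<close>
  define p where "p = real (card A) * exp (- 2 * pi)"
  define q where "q = 2 * real (card B) * exp (- 2 * pi)"
  have p: "p \<ge> 0" "q \<ge> 0" by (auto simp: p_def q_def)
  have card: "card A + card B = n"
  proof -
    have "A \<union> B = {..<n}" "A \<inter> B = {}" "finite A" "finite B" by (auto simp: A_def B_def)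
    thus ?thesis using card_Un_disjoint[of A B] by simp
  qed
  have le: "p * indicator {1..2} t + q * indicator {1/2..<1} t \<le> remainder t" for t :: real
  proof -
    consider "t \<in> {1..2}" | "t \<in> {1/2..<1}" | "t \<notin> {1..2}" "t \<notin> {1/2..<1}" by blast
    thus ?thesis
    proof cases
      case 1
      hence t: "1 \<le> t" "t \<le> 2" by auto
      have "real (card A) * (2 * exp (- pi * 2)) \<le> lattice_theta t - 1"
      proof (rule sum_theta_le_lattice_theta)
        show "a i * t \<le> 2" if "i \<in> A" for i
          using mult_mono[of "a i" 1 t 2] that t a_pos[of i] by (auto simp: A_def)
      qed (use t in \<open>auto simp: A_def\<close>)
      hence "2 * p \<le> lattice_theta t - 1" by (simp add: p_def mult_ac)
      moreover have "t * p \<le> 2 * p" using t p by (intro mult_right_mono) auto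
      ultimately have "p \<le> remainder t" using t by (simp add: remainder_def field_simps)
      thus ?thesis using 1 by simp
    next
      case 2
      hence t: "1/2 \<le> t" "0 < t" "t < 1" by auto
      have "real (card B) * (2 * exp (- pi * 2)) \<le> dual_theta (1 / t) - 1"
      proof (rule unimodular_weights.sum_theta_le_lattice_theta[OF dual])
        show "1 / a i * (1 / t) \<le> 2" if "i \<in> B" for i
        proof -
          have "1 / a i \<le> 1" "1 / t \<le> 2" using that t by (auto simp: B_def field_simps)
          thus ?thesis using mult_mono[of "1 / a i" 1 "1 / t" 2] t by auto
        qed
      qed (use t in \<open>auto simp: B_def\<close>)
      hence q: "q \<le> dual_theta (1 / t) - 1" by (simp add: q_def mult_ac)
      have "t powr 0 \<le> t powr (- real n / 2 - 1)"
        using t by (intro powr_mono') auto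
      hence "1 \<le> t powr (- real n / 2 - 1)" using t by simp
      hence "1 * q \<le> t powr (- real n / 2 - 1) * (dual_theta (1 / t) - 1)"
        using q p by (intro mult_mono) auto
      thus ?thesis using 2 t by (simp add: remainder_less_1)
    next
      case 3
      thus ?thesis using remainder_nonneg by simp
    qed
  qed
  have [simp]: "integrable lborel (indicat_real {1..2::real})"
    by (auto intro!: integrable_real_indicator)
  have [simp]: "integrable lborel (indicat_real {1/2..<1::real})"
  proof (rule integrable_real_indicator)
    have "bounded {1/2..<1::real}"
      by (rule bounded_subset[OF bounded_closed_interval[of "1/2" 1]]) auto
    thus "emeasure lborel {1/2..<1::real} < \<infinity>"
      by (rule emeasure_bounded_finite)
  qed simp
  have "real n * exp (- 2 * pi) = p * measure lborel {1..2::real} + q * measure lborel {1/2..<1::real}"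
    by (simp add: p_def q_def flip: card distrib_right)
  also have "\<dots> = (\<integral>t. p * indicator {1..2} t + q * indicator {1/2..<1::real} t \<partial>lborel)"
    by (subst Bochner_Integration.integral_add) auto
  also have "\<dots> \<le> (\<integral>t. remainder t \<partial>lborel)"
    by (intro integral_mono le remainder_integrable Bochner_Integration.integrable_add) auto
  finally show ?thesis .
qed

lemma zeta_det_le:
  assumes D: "dim_row D = n" "\<And>i. i < n \<Longrightarrow> a i = 1 / (D $$ (i, i))\<^sup>2"
  shows "zeta_det D \<le> exp (2 / real n + euler_mascheroni - ln (4 * pi) - real n * exp (- 2 * pi))"
  using remainder_integral_ge by (simp add: zeta_det_eq[OF D])

end

section \<open>Zeta determinants of orthogonal tori\<close>

lemma unimodular_weights_one: "n > 0 \<Longrightarrow> unimodular_weights n (\<lambda>_. 1)"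
  by unfold_locales auto

text \<open>For equal weights the theta product is a power of a number at least 1, hence increases
  with the dimension. On \<open>(0, 1)\<close> the dual form is used, where the prefactor increases
  as well.\<close>

lemma remainder_one_mono:
  assumes "0 < n" "n \<le> m"
  shows "unimodular_weights.remainder n (\<lambda>_. 1) t \<le> unimodular_weights.remainder m (\<lambda>_. 1) t"
proof -
  interpret N: unimodular_weights n "\<lambda>_. 1" by (rule unimodular_weights_one[OF assms(1)])
  interpret M: unimodular_weights m "\<lambda>_. 1" by (rule unimodular_weights_one) (use assms in auto)
  have theta: "theta t \<ge> 1" if "t > 0" for t
    using N.theta_ge_1[OF assms(1) that] by simp
  have le: "N.lattice_theta t \<le> M.lattice_theta t" "0 \<le> N.lattice_theta t - 1" if "t > 0" for t
    using power_increasing[OF assms(2) theta[OF that]] one_le_power[OF theta[OF that], of n]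
    by (auto simp: N.lattice_theta_def M.lattice_theta_def)
  consider "t \<le> 0" | "0 < t" "t < 1" | "t \<ge> 1" by linarith
  thus ?thesis
  proof cases
    case 1
    thus ?thesis by (simp add: N.remainder_def M.remainder_def)
  next
    case 2
    have "t powr (- real n / 2 - 1) \<le> t powr (- real m / 2 - 1)"
      using 2 assms by (intro powr_mono') auto
    hence "t powr (- real n / 2 - 1) * (N.lattice_theta (1 / t) - 1)
        \<le> t powr (- real m / 2 - 1) * (M.lattice_theta (1 / t) - 1)"
      using le[of "1 / t"] 2 by (intro mult_mono) auto
    thus ?thesis
      using N.remainder_less_1[OF 2] M.remainder_less_1[OF 2] by simp
  next
    case 3
    thus ?thesis using le[of t]
      by (auto simp: N.remainder_def M.remainder_def intro!: divide_right_mono)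
  qed
qed

lemma zeta_det_one:
  assumes "n > 0"
  shows "zeta_det (1\<^sub>m n) = exp (2 / real n + euler_mascheroni - ln (4 * pi)
           - (\<integral>t. unimodular_weights.remainder n (\<lambda>_. 1) t \<partial>lborel))"
  by (rule unimodular_weights.zeta_det_eq[OF unimodular_weights_one[OF assms]]) auto

text \<open>The remainder integral is only shown to be weakly increasing; strictness comes from the
  term \<open>2 / n\<close>.\<close>

lemma zeta_det_one_strict_antimono: "strict_antimono_on {1..} (\<lambda>n. zeta_det (1\<^sub>m n))"
proof (rule monotone_onI)
  fix n m :: nat assume nm: "n \<in> {1..}" "m \<in> {1..}" "n < m"
  have "(\<integral>t. unimodular_weights.remainder n (\<lambda>_. 1) t \<partial>lborel)
     \<le> (\<integral>t. unimodular_weights.remainder m (\<lambda>_. 1) t \<partial>lborel)"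
    using nm by (intro integral_mono remainder_one_mono unimodular_weights.remainder_integrable unimodular_weights_one) auto
  moreover have "2 / real m < 2 / real n"
    using nm by (intro divide_strict_left_mono) auto
  ultimately show "zeta_det (1\<^sub>m m) < zeta_det (1\<^sub>m n)"
    using nm by (simp add: zeta_det_one)
qed

text \<open>A diagonal matrix is upper triangular, so its determinant is the product of its diagonal
  entries; being of modulus 1, it makes the inverse squares of the entries admissible
  weights.\<close>

lemma unit_orthogonal_tori_D:
  assumes D: "D \<in> unit_orthogonal_tori n" and n: "n > 0"
  shows "dim_row D = n" "unimodular_weights n (\<lambda>i. 1 / (D $$ (i, i))\<^sup>2)"
proof -
  have carrier: "D \<in> carrier_mat n n" and diag: "diagonal_mat D" and vol: "\<bar>Determinant.det D\<bar> = 1"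
    using D by (auto simp: unit_orthogonal_tori_def orthogonal_tori_def torus_volume_def)
  show "dim_row D = n" using carrier by auto
  have "upper_triangular D"
    using diag carrier by (auto simp: diagonal_mat_def)
  hence "Determinant.det D = prod_list (diag_mat D)"
    using carrier by (rule det_upper_triangular)
  also have "\<dots> = (\<Prod>i<n. D $$ (i, i))"
    using carrier by (simp add: diag_mat_def prod.list_conv_set_nth atLeast0LessThan)
  finally have det: "\<bar>\<Prod>i<n. D $$ (i, i)\<bar> = 1" using vol by simp
  hence "(\<Prod>i<n. D $$ (i, i)) \<noteq> 0"
    by linarith
  hence nz: "D $$ (i, i) \<noteq> 0" if "i < n" for i
    using that by (auto simp: prod_zero_iff)
  have "(\<Prod>i<n. 1 / (D $$ (i, i))\<^sup>2) = 1 / (\<Prod>i<n. D $$ (i, i))\<^sup>2"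
    by (simp add: prod_dividef prod_power_distrib)
  also have "(\<Prod>i<n. D $$ (i, i))\<^sup>2 = 1"
    using det by (metis power2_abs power_one)
  finally show "unimodular_weights n (\<lambda>i. 1 / (D $$ (i, i))\<^sup>2)"
    using n nz by unfold_locales auto
qed

lemma one_mem_unit_orthogonal_tori: "1\<^sub>m n \<in> unit_orthogonal_tori n"
proof -
  have "diagonal_mat (1\<^sub>m n :: real mat)" by (auto simp: diagonal_mat_def)
  moreover have "invertible_mat (1\<^sub>m n :: real mat)"
    by (auto simp: invertible_mat_def inverts_mat_def intro!: exI[of _ "1\<^sub>m n"])
  ultimately show ?thesis
    by (auto simp: unit_orthogonal_tori_def orthogonal_tori_def torus_volume_def)
qed

theorem mainTheorem3:
  shows "strict_antimono_on {1..} (\<lambda>n. zeta_det (1\<^sub>m n))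
    \<and> (\<lambda>n. zeta_det (1\<^sub>m n)) \<longlonglongrightarrow> 0
    \<and> (\<lambda>n. SUP D\<in>unit_orthogonal_tori n. ereal (zeta_det D)) \<longlonglongrightarrow> 0"
proof (intro conjI zeta_det_one_strict_antimono)
  \<comment> \<open>This majorant depends on the dimension alone, so it controls the supremum over
    all unit tori and the equilateral torus at once.\<close>
  define b where "b n = exp (2 / real n + euler_mascheroni - ln (4 * pi) - real n * exp (- 2 * pi))" for n :: nat
  have le: "zeta_det D \<le> b n" if "D \<in> unit_orthogonal_tori n" "n > 0" for D n
    unfolding b_def
    by (rule unimodular_weights.zeta_det_le[OF unit_orthogonal_tori_D(2)[OF that]])
       (use unit_orthogonal_tori_D(1)[OF that] in auto)
  have b: "b \<longlonglongrightarrow> 0"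
  proof -
    define c where "c = exp (- 2 * pi)"
    define d :: real where "d = euler_mascheroni - ln (4 * pi)"
    have "c > 0" by (simp add: c_def)
    hence "(\<lambda>n. exp (2 / real n + d - real n * c)) \<longlonglongrightarrow> 0"
      by real_asymp
    thus ?thesis by (simp add: b_def[abs_def] c_def d_def algebra_simps)
  qed
  have pos: "zeta_det (1\<^sub>m n) \<ge> 0" if "n > 0" for n
    using zeta_det_one[OF that] by simp
  \<comment> \<open>The estimates are available in positive dimension only, so they enter the limits
    as eventual bounds.\<close>
  have ev: "eventually (\<lambda>n::nat. n > 0) sequentially"
    by (rule eventually_gt_at_top)
  show lim: "(\<lambda>n. zeta_det (1\<^sub>m n)) \<longlonglongrightarrow> 0"
    by (rule tendsto_sandwich[OF _ _ tendsto_const b]; rule eventually_mono[OF ev])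
       (use pos le one_mem_unit_orthogonal_tori in auto)
  show "(\<lambda>n. SUP D\<in>unit_orthogonal_tori n. ereal (zeta_det D)) \<longlonglongrightarrow> 0"
  \<comment> \<open>The equilateral torus competes in the supremum, so its determinant is a lower
    bound tending to 0.\<close>
  proof (rule tendsto_sandwich)
    show "(\<lambda>n. ereal (zeta_det (1\<^sub>m n))) \<longlonglongrightarrow> 0" "(\<lambda>n. ereal (b n)) \<longlonglongrightarrow> 0"
      using lim b by (auto simp: zero_ereal_def)
    show "eventually (\<lambda>n. ereal (zeta_det (1\<^sub>m n)) \<le> (SUP D\<in>unit_orthogonal_tori n. ereal (zeta_det D))) sequentially"
      by (intro always_eventually allI SUP_upper one_mem_unit_orthogonal_tori)
    show "eventually (\<lambda>n. (SUP D\<in>unit_orthogonal_tori n. ereal (zeta_det D)) \<le> ereal (b n)) sequentially"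
      by (rule eventually_mono[OF ev]) (auto intro!: SUP_least le)
  qed
qed

end
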